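(* Let $\Bbbk$ be a field of characteristic zero, let $n\ge2$, $I_n=\{1,\dots,n\}$, let $p:I_n\to\mathbb{Z}_2$ be any function, $p_{ij}:=p(i)+p(j)$, and let $F_q^{\mathrm{int}}[ML_n^p]$ be the $\Bbbk[q,q^{-1}]$-superalgebra defined in the context. Fix any total order on the set of generators $\{x_{ij}\mid i,j\in I_n\}$. Then the set $$\mathbb{B}:=\Big\{\overrightarrow{\prod_{i,j\in I_n}}x_{ij}^{e_{ij}}\ \Big|\ e_{ij}\in\mathbb{N}\ \forall\,i,j\in I_n,\ \ e_{ij}\le1\text{ if }p_{ij}=\bar1\Big\}$$ of all truncated ordered monomials in the $x_{ij}$ (factors multiplied in the fixed order) is a $\Bbbk[q,q^{-1}]$-basis of the $\Bbbk[q,q^{-1}]$-module $F_q^{\mathrm{int}}[ML_n^p]$. In particular, $F_q^{\mathrm{int}}[ML_n^p]$ is a free $\Bbbk[q,q^{-1}]$-module. Likewise, $\mathbb{B}$ is a $\Bbbk(q)$-basis of $F_q[ML_n^p]:=\Bbbk(q)\otimes_{\Bbbk[q,q^{-1}]}F_q^{\mathrm{int}}[ML_n^p]$.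
   Context: $\mathbb{N}$ includes $0$; $\mathbb{Z}_2=\{\bar0,\bar1\}$. Let $q$ be an indeterminate and $q_s:=q^{(-1)^{p(s)}}$ for $s\in I_n$. The superalgebra $F_q^{\mathrm{int}}[ML_n^p]$ is the unital associative $\Bbbk[q,q^{-1}]$-superalgebra generated by $\{x_{ij}\mid i,j\in I_n\}$, with parity $|x_{ij}|=p_{ij}$, subject to the relations $$x_{ij}^2=0\quad(p_{ij}=\bar1),$$ $$x_{ij}x_{ik}=(-1)^{p_{ij}p_{ik}}\,q_i\,x_{ik}x_{ij}\quad(j<k),$$ $$x_{ij}x_{hj}=(-1)^{p_{ij}p_{hj}}\,q_j\,x_{hj}x_{ij}\quad(i<h),$$ $$x_{ij}x_{hk}=(-1)^{p_{ij}p_{hk}}\,x_{hk}x_{ij}\quad(i<h,\ j>k),$$ $$x_{ij}x_{hk}=(-1)^{p_{ij}p_{hk}}\,x_{hk}x_{ij}+(-1)^{p_{ij}p_{ik}}\,(q_i-q_i^{-1})\,x_{ik}x_{hj}\quad(i<h,\ j<k).$$ *)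

theory Defs
  imports
    "HOL-Library.Z2"
    "HOL-Library.FuncSet"
    "HOL-Library.Poly_Mapping"
    "HOL-Computational_Algebra.Polynomial"
    "HOL-Computational_Algebra.Polynomial_Factorial"
    "HOL-Algebra.QuotRing"
    "HOL-Algebra.Free_Abelian_Groups"
    "Jordan_Normal_Form.VS_Connect"
begin

section \<open>The ground rings\<close>

text \<open>Laurent polynomials are the group algebra of the integers: \<open>single m c\<close> is \<open>c q^m\<close>,
  and multiplication of finitely supported functions is convolution.\<close>

type_synonym 'k laurent = "int \<Rightarrow>\<^sub>0 'k"

type_synonym 'k ratfun = "'k poly fract"

definition laurent_to_ratfun :: "'k::field laurent \<Rightarrow> 'k ratfun" where
  "laurent_to_ratfun f =
    (\<Sum>m\<in>Poly_Mapping.keys f. to_fract [:Poly_Mapping.lookup f m:] * to_fract [:0, 1:] powi m)"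

definition bit_sign :: "bit \<Rightarrow> 'a::ring_1" where
  "bit_sign b = (if b = 0 then 1 else - 1)"

definition qs :: "(nat \<Rightarrow> bit) \<Rightarrow> nat \<Rightarrow> 'k::field laurent" where
  "qs p s = Poly_Mapping.single (bit_sign (p s)) 1"

definition qs_inv :: "(nat \<Rightarrow> bit) \<Rightarrow> nat \<Rightarrow> 'k::field laurent" where
  "qs_inv p s = Poly_Mapping.single (- bit_sign (p s)) 1"


section \<open>The free algebra on the generators\<close>

text \<open>Words under concatenation form the free monoid; the wrapper type avoids making the type of
  lists itself an instance of \<^class>\<open>monoid_add\<close>.  The convolution product of finitely supported
  functions on words is then the product of the free algebra.\<close>

datatype 'a free_monoid = Word (letters: "'a list")

instantiation free_monoid :: (type) monoid_add
begin

definition zero_free_monoid :: "'a free_monoid" where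
  "0 = Word []"

definition plus_free_monoid :: "'a free_monoid \<Rightarrow> 'a free_monoid \<Rightarrow> 'a free_monoid" where
  "u + v = Word (letters u @ letters v)"

instance
  by standard (simp_all add: zero_free_monoid_def plus_free_monoid_def)

end

type_synonym 'k free_alg = "(nat \<times> nat) free_monoid \<Rightarrow>\<^sub>0 'k laurent"

definition generators :: "nat \<Rightarrow> (nat \<times> nat) set" where
  "generators n = {1..n} \<times> {1..n}"

definition scalar :: "'k::field laurent \<Rightarrow> 'k free_alg" where
  "scalar c = Poly_Mapping.single 0 c"

definition free_gen :: "nat \<Rightarrow> nat \<Rightarrow> 'k::field free_alg" where
  "free_gen i j = Poly_Mapping.single (Word [(i, j)]) 1"

definition free_algebra :: "nat \<Rightarrow> ('k::field laurent, 'k free_alg) module" where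
  "free_algebra n =
    \<lparr>carrier = {f. \<forall>w\<in>Poly_Mapping.keys f. set (letters w) \<subseteq> generators n},
     monoid.mult = (*), one = 1, ring.zero = 0, add = (+), smult = (\<lambda>c f. scalar c * f)\<rparr>"


section \<open>The quantum function superalgebra over the Laurent polynomials\<close>

text \<open>The generator \<open>free_gen i j\<close> has parity \<open>par p i j\<close>.  All relations below are homogeneous, so the
  quotient inherits the grading; as an algebra it is the quotient by the two-sided ideal the
  relations generate.\<close>

definition par :: "(nat \<Rightarrow> bit) \<Rightarrow> nat \<Rightarrow> nat \<Rightarrow> bit" where
  "par p i j = p i + p j"

definition relations :: "nat \<Rightarrow> (nat \<Rightarrow> bit) \<Rightarrow> 'k::field free_alg set" where
  "relations n p =
    {free_gen i j ^ 2 | i j.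
       i \<in> {1..n} \<and> j \<in> {1..n} \<and> par p i j = 1}
  \<union> {free_gen i j * free_gen i k - scalar (bit_sign (par p i j * par p i k) * qs p i) * (free_gen i k * free_gen i j) | i j k.
       i \<in> {1..n} \<and> j \<in> {1..n} \<and> k \<in> {1..n} \<and> j < k}
  \<union> {free_gen i j * free_gen h j - scalar (bit_sign (par p i j * par p h j) * qs p j) * (free_gen h j * free_gen i j) | i h j.
       i \<in> {1..n} \<and> h \<in> {1..n} \<and> j \<in> {1..n} \<and> i < h}
  \<union> {free_gen i j * free_gen h k - scalar (bit_sign (par p i j * par p h k)) * (free_gen h k * free_gen i j) | i j h k.
       i \<in> {1..n} \<and> j \<in> {1..n} \<and> h \<in> {1..n} \<and> k \<in> {1..n} \<and> i < h \<and> j > k}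
  \<union> {free_gen i j * free_gen h k
       - (scalar (bit_sign (par p i j * par p h k)) * (free_gen h k * free_gen i j)
          + scalar (bit_sign (par p i j * par p i k) * (qs p i - qs_inv p i)) * (free_gen i k * free_gen h j)) | i j h k.
       i \<in> {1..n} \<and> j \<in> {1..n} \<and> h \<in> {1..n} \<and> k \<in> {1..n} \<and> i < h \<and> j < k}"

definition rel_ideal :: "nat \<Rightarrow> (nat \<Rightarrow> bit) \<Rightarrow> 'k::field free_alg set" where
  "rel_ideal n p = genideal (free_algebra n) (relations n p)"

definition Fq_int :: "nat \<Rightarrow> (nat \<Rightarrow> bit) \<Rightarrow> ('k::field laurent, 'k free_alg set) module" where
  "Fq_int n p =
    ring.extend (free_algebra n Quot rel_ideal n p)
      (module.fields
        (\<lambda>c C. \<Union>f\<in>C. rel_ideal n p +>\<^bsub>free_algebra n\<^esub> (c \<odot>\<^bsub>free_algebra n\<^esub> f)))"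

definition gen :: "nat \<Rightarrow> (nat \<Rightarrow> bit) \<Rightarrow> nat \<times> nat \<Rightarrow> 'k::field free_alg set" where
  "gen n p g = rel_ideal n p +>\<^bsub>free_algebra n\<^esub> free_gen (fst g) (snd g)"


section \<open>Truncated ordered monomials\<close>

definition ordered_generators :: "nat \<Rightarrow> (nat \<times> nat) rel \<Rightarrow> (nat \<times> nat) list" where
  "ordered_generators n r =
    (THE gs. set gs = generators n \<and> distinct gs \<and> sorted_wrt (\<lambda>g h. (g, h) \<in> r) gs)"

definition exponents :: "nat \<Rightarrow> (nat \<Rightarrow> bit) \<Rightarrow> (nat \<times> nat \<Rightarrow> nat) set" where
  "exponents n p =
    {e \<in> generators n \<rightarrow>\<^sub>E UNIV. \<forall>(i, j)\<in>generators n. par p i j = 1 \<longrightarrow> e (i, j) \<le> 1}"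

definition monomial ::
    "nat \<Rightarrow> (nat \<Rightarrow> bit) \<Rightarrow> (nat \<times> nat) rel \<Rightarrow> (nat \<times> nat \<Rightarrow> nat) \<Rightarrow> 'k::field free_alg set" where
  "monomial n p r e =
    foldr (\<lambda>g m. gen n p g [^]\<^bsub>Fq_int n p\<^esub> e g \<otimes>\<^bsub>Fq_int n p\<^esub> m)
      (ordered_generators n r) \<one>\<^bsub>Fq_int n p\<^esub>"

definition monomials :: "nat \<Rightarrow> (nat \<Rightarrow> bit) \<Rightarrow> (nat \<times> nat) rel \<Rightarrow> 'k::field free_alg set set" where
  "monomials n p r = monomial n p r ` exponents n p"


section \<open>Extension of scalars\<close>

text \<open>For a ring homomorphism \<open>\<phi>\<close> from \<open>R\<close> to \<open>K\<close> and an \<open>R\<close>-algebra \<open>M\<close>, the tensor product of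
  \<open>K\<close> and \<open>M\<close> over \<open>R\<close> is the free abelian group on the pairs \<open>(a, m)\<close> modulo the
  bilinearity and balancing relations.\<close>

definition tensor_relations ::
    "('c, 'd) ring_scheme \<Rightarrow> ('a \<Rightarrow> 'c) \<Rightarrow> ('a, 'e) ring_scheme \<Rightarrow> ('a, 'm, 'f) module_scheme
      \<Rightarrow> ('c \<times> 'm \<Rightarrow>\<^sub>0 int) set" where
  "tensor_relations K \<phi> R M =
    {frag_of (a \<oplus>\<^bsub>K\<^esub> b, m) - frag_of (a, m) - frag_of (b, m) | a b m.
       a \<in> carrier K \<and> b \<in> carrier K \<and> m \<in> carrier M}
  \<union> {frag_of (a, m \<oplus>\<^bsub>M\<^esub> m') - frag_of (a, m) - frag_of (a, m') | a m m'.
       a \<in> carrier K \<and> m \<in> carrier M \<and> m' \<in> carrier M}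
  \<union> {frag_of (a \<otimes>\<^bsub>K\<^esub> \<phi> c, m) - frag_of (a, c \<odot>\<^bsub>M\<^esub> m) | a c m.
       a \<in> carrier K \<and> c \<in> carrier R \<and> m \<in> carrier M}"

definition tensor_kernel ::
    "('c, 'd) ring_scheme \<Rightarrow> ('a \<Rightarrow> 'c) \<Rightarrow> ('a, 'e) ring_scheme \<Rightarrow> ('a, 'm, 'f) module_scheme
      \<Rightarrow> ('c \<times> 'm \<Rightarrow>\<^sub>0 int) set" where
  "tensor_kernel K \<phi> R M =
    generate (free_Abelian_group (carrier K \<times> carrier M)) (tensor_relations K \<phi> R M)"

definition pure_tensor ::
    "('c, 'd) ring_scheme \<Rightarrow> ('a \<Rightarrow> 'c) \<Rightarrow> ('a, 'e) ring_scheme \<Rightarrow> ('a, 'm, 'f) module_scheme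
      \<Rightarrow> 'c \<Rightarrow> 'm \<Rightarrow> ('c \<times> 'm \<Rightarrow>\<^sub>0 int) set" where
  "pure_tensor K \<phi> R M a m =
    tensor_kernel K \<phi> R M #>\<^bsub>free_Abelian_group (carrier K \<times> carrier M)\<^esub> frag_of (a, m)"

definition base_change ::
    "('c, 'd) ring_scheme \<Rightarrow> ('a \<Rightarrow> 'c) \<Rightarrow> ('a, 'e) ring_scheme \<Rightarrow> ('a, 'm, 'f) module_scheme
      \<Rightarrow> ('c, ('c \<times> 'm \<Rightarrow>\<^sub>0 int) set) module" where
  "base_change K \<phi> R M =
    (let G = free_Abelian_group (carrier K \<times> carrier M); N = tensor_kernel K \<phi> R M in
     \<lparr>carrier = carrier (G Mod N),
      monoid.mult = (\<lambda>S T. \<Union>s\<in>S. \<Union>t\<in>T. N #>\<^bsub>G\<^esub>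
        frag_extend (\<lambda>(a, m). frag_extend (\<lambda>(b, m'). frag_of (a \<otimes>\<^bsub>K\<^esub> b, m \<otimes>\<^bsub>M\<^esub> m')) t) s),
      one = pure_tensor K \<phi> R M \<one>\<^bsub>K\<^esub> \<one>\<^bsub>M\<^esub>,
      ring.zero = \<one>\<^bsub>G Mod N\<^esub>,
      add = monoid.mult (G Mod N),
      smult = (\<lambda>c T. \<Union>t\<in>T. N #>\<^bsub>G\<^esub> frag_extend (\<lambda>(a, m). frag_of (c \<otimes>\<^bsub>K\<^esub> a, m)) t)\<rparr>)"

definition Fq ::
    "nat \<Rightarrow> (nat \<Rightarrow> bit) \<Rightarrow> ('k::field ratfun, ('k ratfun \<times> 'k free_alg set \<Rightarrow>\<^sub>0 int) set) module" where
  "Fq n p = base_change class_ring laurent_to_ratfun class_ring (Fq_int n p)"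

definition to_Fq ::
    "nat \<Rightarrow> (nat \<Rightarrow> bit) \<Rightarrow> 'k::field free_alg set \<Rightarrow> ('k ratfun \<times> 'k free_alg set \<Rightarrow>\<^sub>0 int) set" where
  "to_Fq n p = pure_tensor class_ring laurent_to_ratfun class_ring (Fq_int n p) 1"


section \<open>Bases of modules\<close>

definition module_basis ::
    "('a, 'e) ring_scheme \<Rightarrow> ('a, 'm, 'f) module_scheme \<Rightarrow> 'm set \<Rightarrow> bool" where
  "module_basis R M B \<longleftrightarrow>
    Module.module R M \<and> B \<subseteq> carrier M \<and> LinearCombinations.module.span R M B = carrier M \<and> \<not> LinearCombinations.module.lin_dep R M B"

definition free_module :: "('a, 'e) ring_scheme \<Rightarrow> ('a, 'm, 'f) module_scheme \<Rightarrow> bool" where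
  "free_module R M \<longleftrightarrow> (\<exists>B. module_basis R M B)"

end

theory Submission
  imports Defs "HOL-Library.Multiset"
begin

text \<open>
  Sign twist: rescaling each word by a bicharacter of the row and column degrees (and each generator
  by a sign) removes all parity signs.  With \<open>Q\<^sub>s = (-1)^p(s) q\<^sub>s\<close>, which is \<open>q\<close> or \<open>- q\<^sup>-\<^sup>1\<close>, the
  relations become those of a quantum matrix algebra whose Hecke eigenvalues \<open>Q\<^sub>s\<close> depend on the index,
  and \<open>x\<^sub>i\<^sub>j\<^sup>2 = 0\<close> holds exactly when \<open>Q\<^sub>i \<noteq> Q\<^sub>j\<close>.

  Independence: rewriting words into row-major order terminates, and its critical pairs are resolved by
  the braid relation and the eigenvalue equation of one Hecke operator acting on columns.  So the
  coefficients of normal words are linear functionals on the algebra.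

  Arbitrary orders: give \<open>x\<^sub>i\<^sub>j\<close> the weight \<open>i j\<close>.  Any two generators commute up to a unit and a term of
  strictly smaller weight, so the ordered monomials for any total order span, and the functionals are
  triangular on them with invertible diagonal.  Both facts survive the extension of scalars.
\<close>

section \<open>Words and inversions\<close>

text \<open>Independence is argued dually: no algebra is built on the candidate basis, and one
  studies functions \<open>F\<close> from words to scalars that satisfy
  \<open>F w = reduct F u a b v\<close> at every reducible pair of neighbours. Confluence then is an
  identity between scalars, and Hecke operators enter as operators on functions of three columns.

  Row-major order comes first because a step between different rows always exchanges the rows and
  only redistributes the columns. An overlap of three rows is therefore a product of three Hecke
  operators. An arbitrary total order mixes rows and columns and has no such description, so it is
  reached by triangularity and not by a second confluence proof.

  After the twist, the parities only decide which root of x^2 + lam x = 1, namely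
  \<open>qinv\<close> or \<open>- q\<close>, stands on the diagonal of the operator and which
  letters square to zero. The braid relation needs nothing but the quadratic equation of each
  diagonal entry, so it is blind to parity.\<close>

fun inversions :: "('a \<Rightarrow> 'a \<Rightarrow> bool) \<Rightarrow> 'a list \<Rightarrow> nat" where
  "inversions R [] = 0"
| "inversions R (x # xs) = length (filter (R x) xs) + inversions R xs"

lemma inversions_append:
  "inversions R (u @ v) = inversions R u + inversions R v + (\<Sum>x\<leftarrow>u. length (filter (R x) v))"
  by (induction u) auto

lemma sum_list_filter_swap:
  "(\<Sum>x\<leftarrow>u. length (filter (R x) v)) = (\<Sum>y\<leftarrow>v. length (filter (\<lambda>x. R x y) u))"
proof (induction v)
  case Nil
  then show ?case by (induction u) auto
next
  case (Cons a v)
  have "(\<Sum>x\<leftarrow>u. length (filter (R x) (a # v)))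
      = length (filter (\<lambda>x. R x a) u) + (\<Sum>x\<leftarrow>u. length (filter (R x) v))"
    by (induction u) auto
  with Cons show ?case by simp
qed

text \<open>A letter outside the block sees only how many letters of the block stand in relation to
  it, so replacing \<open>z\<close> by \<open>z'\<close> changes the total by the inner inversions
  alone. Writing sums on both sides avoids subtraction of naturals.\<close>

lemma inversions_context:
  assumes "\<And>x. length (filter (R x) z) = length (filter (R x) z')"
    and "\<And>y. length (filter (\<lambda>x. R x y) z) = length (filter (\<lambda>x. R x y) z')"
  shows "inversions R (u @ z @ v) + inversions R z' = inversions R (u @ z' @ v) + inversions R z"
proof -
  \<comment> \<open>The second hypothesis counts in the block for one fixed outer letter;
    interchanging the two sums brings the count into that form.\<close>
  have "(\<Sum>x\<leftarrow>z. length (filter (R x) v)) = (\<Sum>x\<leftarrow>z'. length (filter (R x) v))"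
    by (rule trans[OF sum_list_filter_swap], rule trans[OF _ sum_list_filter_swap[symmetric]], simp only: assms(2))
  then show ?thesis
    using assms(1) by (simp add: inversions_append)
qed

definition row_greater :: "nat \<times> nat \<Rightarrow> nat \<times> nat \<Rightarrow> bool" where
  "row_greater x y \<longleftrightarrow> fst y < fst x"

definition col_greater :: "nat \<times> nat \<Rightarrow> nat \<times> nat \<Rightarrow> bool" where
  "col_greater x y \<longleftrightarrow> fst y = fst x \<and> snd y < snd x"

text \<open>Exchanging two rows alters the columns of the letters, so only the row inversions can come first.\<close>

definition smaller :: "((nat \<times> nat) list \<times> (nat \<times> nat) list) set" where
  "smaller = measures [inversions row_greater, inversions col_greater]"

lemma wf_smaller: "wf smaller"
  by (simp add: smaller_def)

lemma trans_smaller: "trans smaller"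
  unfolding smaller_def trans_def by auto

text \<open>The columns \<open>k'\<close>, \<open>j'\<close> are independent of \<open>k\<close>,
  \<open>j\<close>, so one statement covers both the swapped word and the exchange term.\<close>

lemma smaller_swap_row:
  assumes "i < h"
  shows "(u @ (i, k') # (h, j') # v, u @ (h, k) # (i, j) # v) \<in> smaller"
proof -
  have "inversions row_greater (u @ [(i, k'), (h, j')] @ v) + inversions row_greater [(h, k), (i, j)]
      = inversions row_greater (u @ [(h, k), (i, j)] @ v) + inversions row_greater [(i, k'), (h, j')]"
    by (rule inversions_context) (auto simp: row_greater_def)
  then show ?thesis
    using assms by (simp add: smaller_def row_greater_def)
qed

lemma smaller_swap_col:
  assumes "j < k"
  shows "(u @ (h, j) # (h, k) # v, u @ (h, k) # (h, j) # v) \<in> smaller"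
proof -
  have "inversions R (u @ [(h, j), (h, k)] @ v) + inversions R [(h, k), (h, j)]
      = inversions R (u @ [(h, k), (h, j)] @ v) + inversions R [(h, j), (h, k)]" for R
    by (rule inversions_context) auto
  from this[of row_greater] this[of col_greater] show ?thesis
    using assms by (simp add: smaller_def row_greater_def col_greater_def)
qed

section \<open>Confluence of the sign-free relations\<close>

locale quantum_parameters =
  fixes q qinv :: "'c::comm_ring_1" and P :: "nat \<Rightarrow> bool"
  assumes q_qinv: "q * qinv = 1"
begin

text \<open>Both possible values of \<open>Q\<close> satisfy the same Hecke relation \<open>Q - Q\<^sup>-\<^sup>1 = q - q\<^sup>-\<^sup>1\<close>.\<close>

definition Q :: "nat \<Rightarrow> 'c" where "Q i = (if P i then - qinv else q)"
definition Qinv :: "nat \<Rightarrow> 'c" where "Qinv i = (if P i then - q else qinv)"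
definition lam :: 'c where "lam = q - qinv"

lemma Q_Qinv: "Q i * Qinv i = 1"
  using q_qinv by (simp add: Q_def Qinv_def mult.commute)

text \<open>For \<open>i < h\<close> the relations read
  \<open>x\<^sub>h\<^sub>k x\<^sub>i\<^sub>j = swap_coeff k j x\<^sub>i\<^sub>j x\<^sub>h\<^sub>k - stay_coeff k j x\<^sub>i\<^sub>k x\<^sub>h\<^sub>j\<close>: exchanging adjacent rows acts on the
  columns by a Hecke operator.  Below, \<open>g x y z\<close> is the value of a functional at a word of three
  letters with fixed rows and columns \<open>x, y, z\<close>.\<close>

definition swap_coeff :: "nat \<Rightarrow> nat \<Rightarrow> 'c" where
  "swap_coeff k j = (if j = k then Qinv k else 1)"

definition stay_coeff :: "nat \<Rightarrow> nat \<Rightarrow> 'c" where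
  "stay_coeff k j = (if j < k then lam else 0)"

definition hecke1 :: "(nat \<Rightarrow> nat \<Rightarrow> nat \<Rightarrow> 'c) \<Rightarrow> nat \<Rightarrow> nat \<Rightarrow> nat \<Rightarrow> 'c" where
  "hecke1 g x y z = swap_coeff x y * g y x z - stay_coeff x y * g x y z"

definition hecke2 :: "(nat \<Rightarrow> nat \<Rightarrow> nat \<Rightarrow> 'c) \<Rightarrow> nat \<Rightarrow> nat \<Rightarrow> nat \<Rightarrow> 'c" where
  "hecke2 g x y z = swap_coeff y z * g x z y - stay_coeff y z * g x y z"

text \<open>Both \<open>qinv\<close> and \<open>- q\<close> are roots of x^2 + lam x = 1. This is
  the quadratic Hecke relation on a pair of equal columns.\<close>

lemma Qinv_square: "Qinv k * Qinv k = 1 - lam * Qinv k"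
  using q_qinv by (auto simp: Qinv_def lam_def algebra_simps)

lemma Qinv_square_mult: "Qinv k * (Qinv k * t) = t - lam * (Qinv k * t)"
  by (simp add: Qinv_square left_diff_distrib flip: mult.assoc)

lemma Qinv_eq: "P i = P j \<Longrightarrow> Qinv i = Qinv j"
  by (simp add: Qinv_def)

text \<open>The product of the two different roots is -1. The extra factor \<open>t\<close> lets the
  equation rewrite inside longer products.\<close>

lemma Qinv_neq: "P i \<noteq> P j \<Longrightarrow> Qinv i * (Qinv j * t) = - t"
proof -
  assume "P i \<noteq> P j"
  then have "Qinv i * Qinv j = - 1"
    using q_qinv by (auto simp: Qinv_def mult.commute)
  then show ?thesis
    by (simp flip: mult.assoc)
qed

lemmas hecke_simps = hecke1_def hecke2_def swap_coeff_def stay_coeff_def algebra_simps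
  Qinv_square Qinv_square_mult

text \<open>Only the relative order of the three columns enters, so this is a finite check. The
  quadratic relation is called for when columns coincide, for instance at \<open>x = y\<close> with
  \<open>z < x\<close>.\<close>

lemma hecke_braid: "hecke1 (hecke2 (hecke1 g)) x y z = hecke2 (hecke1 (hecke2 g)) x y z"
  by (cases x y rule: linorder_cases; cases y z rule: linorder_cases; cases x z rule: linorder_cases)
    (simp_all add: hecke_simps)

text \<open>Two adjacent letters of the same row \<open>h\<close> make \<open>g\<close> an eigenvector of the Hecke operator.\<close>

definition row_symmetric1 :: "nat \<Rightarrow> (nat \<Rightarrow> nat \<Rightarrow> nat \<Rightarrow> 'c) \<Rightarrow> bool" where
  "row_symmetric1 h g \<longleftrightarrow> (\<forall>x y z. (y < x \<longrightarrow> g x y z = Qinv h * g y x z) \<and> (P h \<noteq> P x \<longrightarrow> g x x z = 0))"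

definition row_symmetric2 :: "nat \<Rightarrow> (nat \<Rightarrow> nat \<Rightarrow> nat \<Rightarrow> 'c) \<Rightarrow> bool" where
  "row_symmetric2 h g \<longleftrightarrow> (\<forall>x y z. (z < y \<longrightarrow> g x y z = Qinv h * g x z y) \<and> (P h \<noteq> P y \<longrightarrow> g x y y = 0))"

text \<open>On distinct columns the eigenvalue equation is the commutation rule together with the
  quadratic relation. On equal columns the operator multiplies by \<open>Qinv y\<close>, which is
  \<open>Qinv h\<close> unless the parities differ, and then \<open>g\<close> vanishes
  there.\<close>

lemma hecke1_row_symmetric1:
  assumes "row_symmetric1 h g"
  shows "hecke1 g = (\<lambda>x y z. Qinv h * g x y z)"
proof (intro ext)
  fix x y z
  have g: "y < x \<Longrightarrow> g x y z = Qinv h * g y x z" "P h \<noteq> P x \<Longrightarrow> g x x z = 0" for x y z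
    using assms by (auto simp: row_symmetric1_def)
  show "hecke1 g x y z = Qinv h * g x y z"
  proof (cases x y rule: linorder_cases)
    case less
    then show ?thesis
      using g(1)[of x y z] by (simp add: hecke_simps)
  next
    case equal
    then show ?thesis
      using g(2)[of y z] Qinv_eq[of h y] by (cases "P h = P y") (simp_all add: hecke_simps)
  next
    case greater
    then show ?thesis
      using g(1)[of y x z] by (simp add: hecke_simps)
  qed
qed

lemma hecke2_row_symmetric2:
  assumes "row_symmetric2 h g"
  shows "hecke2 g = (\<lambda>x y z. Qinv h * g x y z)"
proof (intro ext)
  fix x y z
  have g: "z < y \<Longrightarrow> g x y z = Qinv h * g x z y" "P h \<noteq> P y \<Longrightarrow> g x y y = 0" for x y z
    using assms by (auto simp: row_symmetric2_def)
  show "hecke2 g x y z = Qinv h * g x y z"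
  proof (cases y z rule: linorder_cases)
    case less
    then show ?thesis
      using g(1)[of y z x] by (simp add: hecke_simps)
  next
    case equal
    then show ?thesis
      using g(2)[of z x] Qinv_eq[of h z] by (cases "P h = P z") (simp_all add: hecke_simps)
  next
    case greater
    then show ?thesis
      using g(1)[of z y x] by (simp add: hecke_simps)
  qed
qed

lemma hecke1_scale: "hecke1 (\<lambda>x y z. c * g x y z) = (\<lambda>x y z. c * hecke1 g x y z)"
  and hecke2_scale: "hecke2 (\<lambda>x y z. c * g x y z) = (\<lambda>x y z. c * hecke2 g x y z)"
  by (auto simp: hecke1_def hecke2_def algebra_simps intro!: ext)

lemma hecke1_eigen_greater:
  assumes "hecke1 g = (\<lambda>x y z. Qinv h * g x y z)" "x < y"
  shows "g y x z = Qinv h * g x y z"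
  using fun_cong[OF fun_cong[OF fun_cong[OF assms(1), of x], of y], of z] assms(2)
  by (simp add: hecke_simps)

lemma hecke2_eigen_greater:
  assumes "hecke2 g = (\<lambda>x y z. Qinv h * g x y z)" "y < z"
  shows "g x z y = Qinv h * g x y z"
  using fun_cong[OF fun_cong[OF fun_cong[OF assms(1), of x], of y], of z] assms(2)
  by (simp add: hecke_simps)

text \<open>The braid relation transports the eigenvalue \<open>Qinv h\<close> from the second pair
  of columns to the first. The vanishing on equal columns needs its own computation: the eigenvalue
  equation only yields that \<open>q + qinv\<close> annihilates the value up to sign, and in the
  ring \<open>'c\<close> this element may be a zero divisor.\<close>

lemma hecke_row_symmetric1:
  assumes "row_symmetric2 h g"
  shows "row_symmetric1 h (hecke2 (hecke1 g))"
proof -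
  have "hecke1 (hecke2 (hecke1 g)) = hecke2 (hecke1 (hecke2 g))"
    by (intro ext hecke_braid)
  also have "\<dots> = (\<lambda>x y z. Qinv h * hecke2 (hecke1 g) x y z)"
    by (simp add: hecke2_row_symmetric2[OF assms] hecke1_scale hecke2_scale)
  finally have "y < x \<Longrightarrow> hecke2 (hecke1 g) x y z = Qinv h * hecke2 (hecke1 g) y x z" for x y z
    by (rule hecke1_eigen_greater)
  moreover have "hecke2 (hecke1 g) x x z = 0" if "P h \<noteq> P x" for x z
  proof -
    have g: "z < y \<Longrightarrow> g x y z = Qinv h * g x z y" "P h \<noteq> P y \<Longrightarrow> g x y y = 0" for x y z
      using assms by (auto simp: row_symmetric2_def)
    \<comment> \<open>For \<open>z < x\<close> this makes the two terms with factor
      \<open>lam\<close> cancel, while the third term \<open>g z x x\<close> is zero by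
      assumption.\<close>
    have "z < x \<Longrightarrow> Qinv x * g x x z = - g x z x"
      using that g(1)[of z x x] by (simp add: Qinv_neq)
    then show ?thesis
      using that by (cases x z rule: linorder_cases) (simp_all add: hecke_simps g(2))
  qed
  ultimately show ?thesis
    by (simp add: row_symmetric1_def)
qed

lemma hecke_row_symmetric2:
  assumes "row_symmetric1 h g"
  shows "row_symmetric2 h (hecke1 (hecke2 g))"
proof -
  have "hecke2 (hecke1 (hecke2 g)) = hecke1 (hecke2 (hecke1 g))"
    by (intro ext hecke_braid[symmetric])
  also have "\<dots> = (\<lambda>x y z. Qinv h * hecke1 (hecke2 g) x y z)"
    by (simp add: hecke1_row_symmetric1[OF assms] hecke1_scale hecke2_scale)
  finally have "z < y \<Longrightarrow> hecke1 (hecke2 g) x y z = Qinv h * hecke1 (hecke2 g) x z y" for x y z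
    by (rule hecke2_eigen_greater)
  moreover have "hecke1 (hecke2 g) x y y = 0" if "P h \<noteq> P y" for x y
  proof -
    have g: "y < x \<Longrightarrow> g x y z = Qinv h * g y x z" "P h \<noteq> P x \<Longrightarrow> g x x z = 0" for x y z
      using assms by (auto simp: row_symmetric1_def)
    have "y < x \<Longrightarrow> Qinv y * g x y y = - g y x y"
      using that g(1)[of y x y] by (simp add: Qinv_neq)
    then show ?thesis
      using that by (cases x y rule: linorder_cases) (simp_all add: hecke_simps g(2))
  qed
  ultimately show ?thesis
    by (simp add: row_symmetric2_def)
qed

end

text \<open>Row inversions do not see columns, so the columns of \<open>z\<close> and
  \<open>z'\<close> are unrelated. The overlap proofs need this freedom, as Hecke operators exchange
  columns while the rows are being sorted.\<close>

lemma smaller_rows: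
  assumes "mset (map fst z) = mset (map fst z')"
    and "inversions row_greater z < inversions row_greater z'"
  shows "(u @ z @ v, u @ z' @ v) \<in> smaller"
proof -
  have count: "length (filter (\<lambda>y. Pr (fst y)) z) = length (filter (\<lambda>y. Pr (fst y)) z')" for Pr
    using arg_cong[OF assms(1), of "\<lambda>M. size (filter_mset Pr M)"]
    by (simp add: filter_mset_image_mset flip: mset_filter)
  have "inversions row_greater (u @ z @ v) + inversions row_greater z'
      = inversions row_greater (u @ z' @ v) + inversions row_greater z"
    by (rule inversions_context)
      (simp_all add: row_greater_def[abs_def] count[of "\<lambda>i. i < _"] count[of "\<lambda>i. _ < i"])
  then show ?thesis
    using assms(2) by (simp add: smaller_def)
qed

text \<open>Replacing \<open>x\<^sub>h\<^sub>k x\<^sub>i\<^sub>j\<close> by \<open>x\<^sub>i\<^sub>k x\<^sub>h\<^sub>j\<close> lowers this weight by \<open>(h - i) (k - j)\<close>.\<close>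

definition weight :: "(nat \<times> nat) list \<Rightarrow> nat" where
  "weight w = (\<Sum>a\<leftarrow>w. fst a * snd a)"

lemma weight_append [simp]: "weight (u @ v) = weight u + weight v"
  and weight_Nil [simp]: "weight [] = 0"
  and weight_Cons [simp]: "weight (a # v) = fst a * snd a + weight v"
  by (simp_all add: weight_def)

lemma weight_mset: "mset t = mset w \<Longrightarrow> weight t = weight w"
  by (simp add: weight_def flip: sum_mset_sum_list)

lemma weight_exchange:
  assumes "i < h" "j < (k::nat)"
  shows "weight (u @ (i, k) # (h, j) # v) < weight (u @ (h, k) # (i, j) # v)"
proof -
  obtain d e where "h = i + Suc d" "k = j + Suc e"
    using assms by (metis less_imp_Suc_add add_Suc_right)
  then show ?thesis
    by (simp add: algebra_simps)
qed

section \<open>Rewriting steps as equations for functions on words\<close>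

context quantum_parameters
begin

definition descent :: "nat \<times> nat \<Rightarrow> nat \<times> nat \<Rightarrow> bool" where
  "descent a b \<longleftrightarrow> fst b < fst a \<or> fst b = fst a \<and> snd b < snd a"

definition null_square :: "nat \<times> nat \<Rightarrow> nat \<times> nat \<Rightarrow> bool" where
  "null_square a b \<longleftrightarrow> a = b \<and> P (fst a) \<noteq> P (snd a)"

definition reducible :: "nat \<times> nat \<Rightarrow> nat \<times> nat \<Rightarrow> bool" where
  "reducible a b \<longleftrightarrow> descent a b \<or> null_square a b"

definition normal_word :: "(nat \<times> nat) list \<Rightarrow> bool" where
  "normal_word w \<longleftrightarrow> (\<forall>u a b v. w = u @ a # b # v \<longrightarrow> \<not> reducible a b)"

text \<open>This is the value that the relations force on \<open>F\<close> at
  \<open>u @ a # b # v\<close>. The null square is tested first, because a repeated letter would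
  otherwise fall into the same-row branch.\<close>

definition reduct ::
    "((nat \<times> nat) list \<Rightarrow> 'c) \<Rightarrow> (nat \<times> nat) list \<Rightarrow> nat \<times> nat \<Rightarrow> nat \<times> nat \<Rightarrow> (nat \<times> nat) list \<Rightarrow> 'c" where
  "reduct F u a b v =
    (if null_square a b then 0
     else if fst a = fst b then Qinv (fst a) * F (u @ b # a # v)
     else swap_coeff (snd a) (snd b) * F (u @ b # a # v)
       - stay_coeff (snd a) (snd b) * F (u @ (fst b, snd a) # (fst a, snd b) # v))"

definition coeff_step where
  "coeff_step t F w =
    (if normal_word w then of_bool (w = t)
     else case SOME (u, a, b, v). w = u @ a # b # v \<and> reducible a b of
       (u, a, b, v) \<Rightarrow> reduct F u a b v)"

text \<open>The coefficient of the normal word \<open>t\<close> in the normal form of a word; by confluence the position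
  chosen by \<open>SOME\<close> does not matter.\<close>

definition normal_coeff :: "(nat \<times> nat) list \<Rightarrow> (nat \<times> nat) list \<Rightarrow> 'c" where
  "normal_coeff t = wfrec smaller (coeff_step t)"

lemma smaller_reducible:
  assumes "reducible a b" "\<not> null_square a b"
  shows "(u @ b # a # v, u @ a # b # v) \<in> smaller"
    and "fst a \<noteq> fst b \<Longrightarrow> (u @ (fst b, snd a) # (fst a, snd b) # v, u @ a # b # v) \<in> smaller"
  using assms smaller_swap_row[of "fst b" "fst a"] smaller_swap_col[of "snd b" "snd a" u "fst a" v]
  by (cases a; cases b; auto simp: reducible_def descent_def)+

text \<open>A reduct evaluates its function at smaller words only, which is what allows the
  well-founded recursion to be unfolded.\<close>

lemma reduct_cong:
  assumes "reducible a b" "\<And>w. (w, u @ a # b # v) \<in> smaller \<Longrightarrow> F w = G w"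
  shows "reduct F u a b v = reduct G u a b v"
  using assms smaller_reducible[OF assms(1)] by (simp add: reduct_def)

lemma normal_coeff_normal: "normal_word w \<Longrightarrow> normal_coeff t w = of_bool (w = t)"
  unfolding normal_coeff_def by (subst wfrec[OF wf_smaller]) (simp add: coeff_step_def)

lemma normal_coeff_some:
  assumes "\<not> normal_word w"
  shows "\<exists>u a b v. w = u @ a # b # v \<and> reducible a b \<and> normal_coeff t w = reduct (normal_coeff t) u a b v"
proof -
  obtain u a b v where
    eq: "(SOME (u, a, b, v). w = u @ a # b # v \<and> reducible a b) = (u, a, b, v)"
    by (rule prod_cases4)
  have "case (SOME (u, a, b, v). w = u @ a # b # v \<and> reducible a b) of (u, a, b, v) \<Rightarrow> w = u @ a # b # v \<and> reducible a b"
    by (rule someI_ex) (use assms in \<open>auto simp: normal_word_def\<close>)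
  then have w: "w = u @ a # b # v" "reducible a b"
    by (auto simp: eq)
  have "normal_coeff t w = reduct (cut (normal_coeff t) smaller w) u a b v"
    unfolding normal_coeff_def
    by (subst wfrec[OF wf_smaller]) (use assms in \<open>simp add: coeff_step_def eq\<close>)
  also have "\<dots> = reduct (normal_coeff t) u a b v"
    by (rule reduct_cong) (use w in \<open>auto simp: cut_apply\<close>)
  finally show ?thesis
    using w by blast
qed

lemma reduct_row:
  "i < h \<Longrightarrow> reduct F u (h, k) (i, j) v =
    swap_coeff k j * F (u @ (i, j) # (h, k) # v) - stay_coeff k j * F (u @ (i, k) # (h, j) # v)"
  by (simp add: reduct_def null_square_def)

text \<open>Absence of ambiguity at one word. The overlap lemmas assume it for all smaller words, so
  that both competing reducts can be evaluated further.\<close>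

definition consistent_at where
  "consistent_at F w \<longleftrightarrow> (\<forall>u a b v. w = u @ a # b # v \<longrightarrow> reducible a b \<longrightarrow> F w = reduct F u a b v)"

lemma consistent_atD:
  "consistent_at F (u @ a # b # v) \<Longrightarrow> reducible a b \<Longrightarrow> F (u @ a # b # v) = reduct F u a b v"
  unfolding consistent_at_def by blast

section \<open>Local confluence\<close>

lemma reduct_disjoint:
  assumes red: "reducible a b" "reducible c d"
    and con: "\<And>w. (w, u @ a # b # m @ c # d # v) \<in> smaller \<Longrightarrow> consistent_at F w"
  shows "reduct F u a b (m @ c # d # v) = reduct F (u @ a # b # m) c d v"
proof -
  note s1 = smaller_reducible[OF red(1), of u "m @ c # d # v"]
  note s2 = smaller_reducible[OF red(2), of "u @ a # b # m" v, simplified]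
  have r1: "F (u @ x # y # m @ c # d # v) = reduct F (u @ x # y # m) c d v"
    if "(u @ x # y # m @ c # d # v, u @ a # b # m @ c # d # v) \<in> smaller" for x y
    using consistent_atD[of F "u @ x # y # m" c d v] con[OF that] red by simp
  have r2: "F (u @ a # b # m @ x # y # v) = reduct F u a b (m @ x # y # v)"
    if "(u @ a # b # m @ x # y # v, u @ a # b # m @ c # d # v) \<in> smaller" for x y
    using consistent_atD[of F u a b "m @ x # y # v"] con[OF that] red by simp
  show ?thesis
    using s1 s2
    by (auto simp: reduct_def[of F u a b "m @ c # d # v"] reduct_def[of F "u @ a # b # m" c d v] r1 r2)
      (auto simp: reduct_def algebra_simps)
qed

text \<open>A step on the first two letters is \<open>hecke1\<close> and a step on the last two is
  \<open>hecke2\<close>. Reversing three rows starting from the left or from the right gives the two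
  sides of the braid relation.\<close>

lemma reduct_overlap_rows:
  assumes rows: "h3 < h2" "h2 < h1"
    and con: "\<And>w. (w, u @ (h1, x) # (h2, y) # (h3, z) # v) \<in> smaller \<Longrightarrow> consistent_at F w"
  shows "reduct F u (h1, x) (h2, y) ((h3, z) # v) = reduct F (u @ [(h1, x)]) (h2, y) (h3, z) v"
proof -
  let ?F = "\<lambda>i j k x y z. F (u @ (i, x) # (j, y) # (k, z) # v)"
  have red: "reducible (h, k) (i, j)" if "i < h" for h i j k
    using that by (simp add: reducible_def descent_def)
  have rows13: "h3 < h1"
    using rows by simp
  \<comment> \<open>The digits record the order of the rows, here \<open>h2\<close>,
    \<open>h1\<close>, \<open>h3\<close>. The columns stay arbitrary.\<close>
  have s213: "(u @ (h2, x') # (h1, y') # (h3, z') # v, u @ (h1, x) # (h2, y) # (h3, z) # v) \<in> smaller" for x' y' z'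
    using smaller_rows[of "[(h2, x'), (h1, y'), (h3, z')]" "[(h1, x), (h2, y), (h3, z)]" u v] rows
    by (simp add: row_greater_def add_mset_commute)
  have s231: "(u @ (h2, x') # (h3, y') # (h1, z') # v, u @ (h1, x) # (h2, y) # (h3, z) # v) \<in> smaller" for x' y' z'
    using smaller_rows[of "[(h2, x'), (h3, y'), (h1, z')]" "[(h1, x), (h2, y), (h3, z)]" u v] rows
    by (simp add: row_greater_def add_mset_commute)
  have s132: "(u @ (h1, x') # (h3, y') # (h2, z') # v, u @ (h1, x) # (h2, y) # (h3, z) # v) \<in> smaller" for x' y' z'
    using smaller_rows[of "[(h1, x'), (h3, y'), (h2, z')]" "[(h1, x), (h2, y), (h3, z)]" u v] rows
    by (simp add: row_greater_def add_mset_commute)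
  have s312: "(u @ (h3, x') # (h1, y') # (h2, z') # v, u @ (h1, x) # (h2, y) # (h3, z) # v) \<in> smaller" for x' y' z'
    using smaller_rows[of "[(h3, x'), (h1, y'), (h2, z')]" "[(h1, x), (h2, y), (h3, z)]" u v] rows
    by (simp add: row_greater_def add_mset_commute)
  have e213: "?F h2 h1 h3 x' y' z' = hecke2 (?F h2 h3 h1) x' y' z'" for x' y' z'
    using consistent_atD[OF _ red[OF rows13], of F "u @ [(h2, x')]" y' z' v] con[OF s213]
    by (simp add: reduct_row[OF rows13] hecke2_def)
  have e231: "?F h2 h3 h1 = hecke1 (?F h3 h2 h1)"
    using consistent_atD[OF con[OF s231] red[OF rows(1)]]
    by (simp add: reduct_row[OF rows(1)] hecke1_def fun_eq_iff)
  have e132: "?F h1 h3 h2 x' y' z' = hecke1 (?F h3 h1 h2) x' y' z'" for x' y' z'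
    using consistent_atD[OF con[OF s132] red[OF rows13]]
    by (simp add: reduct_row[OF rows13] hecke1_def)
  have e312: "?F h3 h1 h2 x' y' z' = hecke2 (?F h3 h2 h1) x' y' z'" for x' y' z'
    using consistent_atD[OF _ red[OF rows(2)], of F "u @ [(h3, x')]" y' z' v] con[OF s312]
    by (simp add: reduct_row[OF rows(2)] hecke2_def)
  have "reduct F u (h1, x) (h2, y) ((h3, z) # v) = hecke1 (hecke2 (hecke1 (?F h3 h2 h1))) x y z"
    by (simp add: reduct_row[OF rows(2)] e213 e231 hecke1_def hecke2_def)
  also have "\<dots> = hecke2 (hecke1 (hecke2 (?F h3 h2 h1))) x y z"
    by (rule hecke_braid)
  also have "\<dots> = reduct F (u @ [(h1, x)]) (h2, y) (h3, z) v"
    by (simp add: reduct_row[OF rows(1)] e132 e312 hecke1_def hecke2_def)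
  finally show ?thesis .
qed

text \<open>Moving the letter of row \<open>l\<close> to the front leaves two neighbours of row
  \<open>h\<close> on the right, where \<open>F\<close> is already known to be row symmetric.
  \<open>hecke_row_symmetric1\<close> carries this symmetry back to the left pair.\<close>

lemma reduct_overlap_upper:
  assumes row: "l < h" and xy: "reducible (h, x) (h, y)"
    and con: "\<And>w. (w, u @ (h, x) # (h, y) # (l, z) # v) \<in> smaller \<Longrightarrow> consistent_at F w"
  shows "reduct F u (h, x) (h, y) ((l, z) # v) = reduct F (u @ [(h, x)]) (h, y) (l, z) v"
proof -
  let ?F = "\<lambda>i j k x y z. F (u @ (i, x) # (j, y) # (k, z) # v)"
  let ?w = "u @ (h, x) # (h, y) # (l, z) # v"
  have red: "reducible (h, k) (l, j)" for j k
    using row by (simp add: reducible_def descent_def)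
  \<comment> \<open>In these labels \<open>1\<close> stands for the row \<open>l\<close> and
    \<open>2\<close> for the row \<open>h\<close>.\<close>
  have s212: "(u @ (h, x') # (l, y') # (h, z') # v, ?w) \<in> smaller" for x' y' z'
    using smaller_rows[of "[(h, x'), (l, y'), (h, z')]" "[(h, x), (h, y), (l, z)]" u v] row
    by (simp add: row_greater_def add_mset_commute)
  have s122: "(u @ (l, x') # (h, y') # (h, z') # v, ?w) \<in> smaller" for x' y' z'
    using smaller_rows[of "[(l, x'), (h, y'), (h, z')]" "[(h, x), (h, y), (l, z)]" u v] row
    by (simp add: row_greater_def add_mset_commute)
  have e212: "?F h l h = hecke1 (?F l h h)"
    using consistent_atD[OF con[OF s212] red]
    by (simp add: reduct_row[OF row] hecke1_def fun_eq_iff)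
  have sym: "row_symmetric2 h (?F l h h)"
    unfolding row_symmetric2_def
  proof (intro allI conjI impI)
    fix x' y' z' :: nat
    assume "z' < y'"
    then have "reducible (h, y') (h, z')" "\<not> null_square (h, y') (h, z')"
      by (auto simp: reducible_def descent_def null_square_def)
    then show "?F l h h x' y' z' = Qinv h * ?F l h h x' z' y'"
      using consistent_atD[of F "u @ [(l, x')]" "(h, y')" "(h, z')" v] con[OF s122]
      by (simp add: reduct_def)
  next
    fix x' y' :: nat
    assume "P h \<noteq> P y'"
    then have "null_square (h, y') (h, y')"
      by (simp add: null_square_def)
    then show "?F l h h x' y' y' = 0"
      using consistent_atD[of F "u @ [(l, x')]" "(h, y')" "(h, y')" v] con[OF s122]
      by (simp add: reduct_def reducible_def)
  qed
  then have rs: "row_symmetric1 h (hecke2 (?F h l h))"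
    unfolding e212 by (rule hecke_row_symmetric1)
  have rhs: "reduct F (u @ [(h, x)]) (h, y) (l, z) v = hecke2 (?F h l h) x y z"
    by (simp add: reduct_row[OF row] hecke2_def)
  show ?thesis
  proof (cases "null_square (h, x) (h, y)")
    case True
    then have "hecke2 (?F h l h) x y z = 0"
      using rs by (auto simp: row_symmetric1_def null_square_def)
    moreover have "reduct F u (h, x) (h, y) ((l, z) # v) = 0"
      using True by (simp add: reduct_def)
    ultimately show ?thesis
      by (simp add: rhs)
  next
    case False
    then have "y < x"
      using xy by (simp add: reducible_def descent_def)
    \<comment> \<open>Here the row inversions tie and the column inversions make the word smaller;
      it is evaluated at its last two letters.\<close>
    have "?F h h l y x z = hecke2 (?F h l h) y x z"
      using consistent_atD[of F "u @ [(h, y)]" "(h, x)" "(l, z)" v] con[OF smaller_swap_col[OF \<open>y < x\<close>]] red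
      by (simp add: reduct_row[OF row] hecke2_def)
    then have "reduct F u (h, x) (h, y) ((l, z) # v) = Qinv h * hecke2 (?F h l h) y x z"
      using False by (simp add: reduct_def)
    also have "\<dots> = hecke2 (?F h l h) x y z"
      using rs \<open>y < x\<close> by (simp add: row_symmetric1_def)
    finally show ?thesis
      by (simp add: rhs)
  qed
qed

text \<open>The mirror image: the symmetry is known on the left pair of row \<open>l\<close> and is
  transported to the right pair. The labels again use \<open>1\<close> for \<open>l\<close> and
  \<open>2\<close> for \<open>h\<close>.\<close>

lemma reduct_overlap_lower:
  assumes row: "l < h" and yz: "reducible (l, y) (l, z)"
    and con: "\<And>w. (w, u @ (h, x) # (l, y) # (l, z) # v) \<in> smaller \<Longrightarrow> consistent_at F w"
  shows "reduct F u (h, x) (l, y) ((l, z) # v) = reduct F (u @ [(h, x)]) (l, y) (l, z) v"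
proof -
  let ?F = "\<lambda>i j k x y z. F (u @ (i, x) # (j, y) # (k, z) # v)"
  let ?w = "u @ (h, x) # (l, y) # (l, z) # v"
  have red: "reducible (h, k) (l, j)" for j k
    using row by (simp add: reducible_def descent_def)
  have s121: "(u @ (l, x') # (h, y') # (l, z') # v, ?w) \<in> smaller" for x' y' z'
    using smaller_rows[of "[(l, x'), (h, y'), (l, z')]" "[(h, x), (l, y), (l, z)]" u v] row
    by (simp add: row_greater_def add_mset_commute)
  have s112: "(u @ (l, x') # (l, y') # (h, z') # v, ?w) \<in> smaller" for x' y' z'
    using smaller_rows[of "[(l, x'), (l, y'), (h, z')]" "[(h, x), (l, y), (l, z)]" u v] row
    by (simp add: row_greater_def add_mset_commute)
  have e121: "?F l h l x' y' z' = hecke2 (?F l l h) x' y' z'" for x' y' z'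
    using consistent_atD[OF _ red, of F "u @ [(l, x')]" y' z' v] con[OF s121]
    by (simp add: reduct_row[OF row] hecke2_def)
  have sym: "row_symmetric1 l (?F l l h)"
    unfolding row_symmetric1_def
  proof (intro allI conjI impI)
    fix x' y' z' :: nat
    assume "y' < x'"
    then have "reducible (l, x') (l, y')" "\<not> null_square (l, x') (l, y')"
      by (auto simp: reducible_def descent_def null_square_def)
    then show "?F l l h x' y' z' = Qinv l * ?F l l h y' x' z'"
      using consistent_atD[of F u "(l, x')" "(l, y')"] con[OF s112]
      by (simp add: reduct_def)
  next
    fix x' z' :: nat
    assume "P l \<noteq> P x'"
    then have "null_square (l, x') (l, x')"
      by (simp add: null_square_def)
    then show "?F l l h x' x' z' = 0"
      using consistent_atD[of F u "(l, x')" "(l, x')"] con[OF s112]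
      by (simp add: reduct_def reducible_def)
  qed
  have "?F l h l = hecke2 (?F l l h)"
    by (intro ext e121)
  then have rs: "row_symmetric2 l (hecke1 (?F l h l))"
    using hecke_row_symmetric2[OF sym] by simp
  have lhs: "reduct F u (h, x) (l, y) ((l, z) # v) = hecke1 (?F l h l) x y z"
    by (simp add: reduct_row[OF row] hecke1_def)
  show ?thesis
  proof (cases "null_square (l, y) (l, z)")
    case True
    then have "hecke1 (?F l h l) x y z = 0"
      using rs by (auto simp: row_symmetric2_def null_square_def)
    moreover have "reduct F (u @ [(h, x)]) (l, y) (l, z) v = 0"
      using True by (simp add: reduct_def)
    ultimately show ?thesis
      by (simp add: lhs)
  next
    case False
    then have "z < y"
      using yz by (simp add: reducible_def descent_def)
    have "(u @ (h, x) # (l, z) # (l, y) # v, ?w) \<in> smaller"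
      using smaller_swap_col[OF \<open>z < y\<close>, of "u @ [(h, x)]"] by simp
    then have "?F h l l x z y = hecke1 (?F l h l) x z y"
      using consistent_atD[OF con red] by (simp add: reduct_row[OF row] hecke1_def)
    then have "reduct F (u @ [(h, x)]) (l, y) (l, z) v = Qinv l * hecke1 (?F l h l) x z y"
      using False by (simp add: reduct_def)
    also have "\<dots> = hecke1 (?F l h l) x y z"
      using rs \<open>z < y\<close> by (simp add: row_symmetric2_def)
    finally show ?thesis
      by (simp add: lhs)
  qed
qed

text \<open>Within one row both routes pay one factor \<open>Qinv h\<close> for each transposition
  of columns. If a letter with vanishing square is repeated, both routes end in zero.\<close>

lemma reduct_overlap_equal:
  assumes xy: "reducible (h, x) (h, y)" and yz: "reducible (h, y) (h, z)"
    and con: "\<And>w. (w, u @ (h, x) # (h, y) # (h, z) # v) \<in> smaller \<Longrightarrow> consistent_at F w"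
  shows "reduct F u (h, x) (h, y) ((h, z) # v) = reduct F (u @ [(h, x)]) (h, y) (h, z) v"
proof -
  let ?F = "\<lambda>x y z. F (u @ (h, x) # (h, y) # (h, z) # v)"
  let ?w = "u @ (h, x) # (h, y) # (h, z) # v"
  have red: "reducible (h, k) (h, j)" "\<not> null_square (h, k) (h, j)" if "j < k" for j k
    using that by (auto simp: reducible_def descent_def null_square_def)
  have swap1: "?F k j i = Qinv h * ?F j k i"
    if "j < k" "(u @ (h, k) # (h, j) # (h, i) # v, ?w) \<in> smaller" for i j k
    using consistent_atD[OF con[OF that(2)] red(1)[OF that(1)]] red(2)[OF that(1)]
    by (simp add: reduct_def)
  have swap2: "?F i k j = Qinv h * ?F i j k"
    if "j < k" "(u @ (h, i) # (h, k) # (h, j) # v, ?w) \<in> smaller" for i j k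
    using consistent_atD[of F "u @ [(h, i)]" "(h, k)" "(h, j)" v] con[OF that(2)] red[OF that(1)]
    by (simp add: reduct_def)
  have null1: "?F k k i = 0"
    if "P h \<noteq> P k" "(u @ (h, k) # (h, k) # (h, i) # v, ?w) \<in> smaller" for i k
    using consistent_atD[OF con[OF that(2)]] that(1)
    by (simp add: reduct_def reducible_def null_square_def)
  have null2: "?F i k k = 0"
    if "P h \<noteq> P k" "(u @ (h, i) # (h, k) # (h, k) # v, ?w) \<in> smaller" for i k
    using consistent_atD[of F "u @ [(h, i)]" "(h, k)" "(h, k)" v] con[OF that(2)] that(1)
    by (simp add: reduct_def reducible_def null_square_def)
  have step1: "y < x \<Longrightarrow> (u @ (h, y) # (h, x) # (h, z) # v, ?w) \<in> smaller"
    by (rule smaller_swap_col)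
  have step2: "z < y \<Longrightarrow> (u @ (h, x) # (h, z) # (h, y) # v, ?w) \<in> smaller"
    using smaller_swap_col[of z y "u @ [(h, x)]"] by simp
  have step12: "(u @ (h, y) # (h, z) # (h, x) # v, ?w) \<in> smaller" if "y < x" "z < x"
    using transD[OF trans_smaller smaller_swap_col[OF that(2), of "u @ [(h, y)]", simplified] step1[OF that(1)]]
    by simp
  have step21: "(u @ (h, z) # (h, x) # (h, y) # v, ?w) \<in> smaller" if "z < y" "z < x"
    using transD[OF trans_smaller smaller_swap_col[OF that(2)] step2[OF that(1)]]
    by simp
  consider "null_square (h, x) (h, y)" "null_square (h, y) (h, z)"
    | "null_square (h, x) (h, y)" "z < y" "\<not> null_square (h, y) (h, z)"
    | "y < x" "null_square (h, y) (h, z)" "\<not> null_square (h, x) (h, y)"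
    | "y < x" "z < y" "\<not> null_square (h, x) (h, y)" "\<not> null_square (h, y) (h, z)"
    using xy yz by (auto simp: reducible_def descent_def)
  then show ?thesis
  proof cases
    case 1
    then show ?thesis
      by (simp add: reduct_def)
  next
    case 2
    then have "x = y" "P h \<noteq> P y"
      by (auto simp: null_square_def)
    with 2 step2 step21 swap1[of z x y] null2[of y z] show ?thesis
      by (simp add: reduct_def)
  next
    case 3
    then have "z = y" "P h \<noteq> P y"
      by (auto simp: null_square_def)
    with 3 step1 step12 swap2[of z x y] null1[of y x] show ?thesis
      by (simp add: reduct_def)
  next
    case 4
    then show ?thesis
      using step1 step2 step12 step21 swap2[of z x y] swap1[of z y x] swap1[of z x y] swap2[of y x z]
        smaller_swap_col[of z y u h "(h, x) # v"]
      by (simp add: reduct_def)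
  qed
qed

lemma reduct_overlap:
  assumes ab: "reducible a b" and bc: "reducible b c"
    and con: "\<And>w. (w, u @ a # b # c # v) \<in> smaller \<Longrightarrow> consistent_at F w"
  shows "reduct F u a b (c # v) = reduct F (u @ [a]) b c v"
proof -
  obtain h1 x h2 y h3 z where abc: "a = (h1, x)" "b = (h2, y)" "c = (h3, z)"
    by (cases a; cases b; cases c)
  consider "h3 < h2" "h2 < h1" | "h3 < h2" "h2 = h1" | "h3 = h2" "h2 < h1" | "h3 = h2" "h2 = h1"
    using ab bc by (auto simp: abc reducible_def descent_def null_square_def)
  then show ?thesis
  proof cases
    case 1
    then show ?thesis
      using reduct_overlap_rows con by (simp add: abc)
  next
    case 2
    then show ?thesis
      using reduct_overlap_upper[OF 2(1)] ab con by (simp add: abc)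
  next
    case 3
    then show ?thesis
      using reduct_overlap_lower[OF 3(2)] bc con by (simp add: abc)
  next
    case 4
    then show ?thesis
      using reduct_overlap_equal ab bc con by (simp add: abc)
  qed
qed

lemma reduct_confluent:
  assumes eq: "u @ a # b # v = u' @ c # d # v'"
    and red: "reducible a b" "reducible c d"
    and con: "\<And>w. (w, u @ a # b # v) \<in> smaller \<Longrightarrow> consistent_at F w"
    and len: "length u \<le> length u'"
  shows "reduct F u a b v = reduct F u' c d v'"
proof -
  obtain m where u': "u' = u @ m"
    using eq len by (metis append_eq_append_conv_if append_eq_conv_conj append_take_drop_id)
  then have m: "a # b # v = m @ c # d # v'"
    using eq by simp
  \<comment> \<open>The cases are: the same pair, pairs sharing one letter, disjoint pairs. The rule
    \<open>remdups_adj.cases\<close> is borrowed for its split into lists of length 0, 1 and at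
    least 2.\<close>
  consider "m = []" | "m = [a]" | m' where "m = a # b # m'"
    using m by (cases m rule: remdups_adj.cases) auto
  then show ?thesis
  proof cases
    case 1
    then show ?thesis
      using m u' by simp
  next
    case 2
    then show ?thesis
      using m u' reduct_overlap[of a b d u v' F] red con by simp
  next
    case 3
    then show ?thesis
      using m u' reduct_disjoint[of a b c d u m' v' F] red con by simp
  qed
qed

text \<open>Newman's argument: along \<open>smaller\<close>, local confluence shows that the
  position picked by the recursion gives the same value as any other reducible position.\<close>

theorem normal_coeff_reduct:
  "reducible a b \<Longrightarrow> normal_coeff t (u @ a # b # v) = reduct (normal_coeff t) u a b v"
proof -
  have "consistent_at (normal_coeff t) w" for w
    using wf_smaller
  proof (induction w)
    case (less w)
    show ?case
      unfolding consistent_at_def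
    proof (intro allI impI)
      fix u a b v
      assume w: "w = u @ a # b # v" and ab: "reducible a b"
      then have "\<not> normal_word w"
        unfolding normal_word_def by blast
      then obtain u' c d v' where w': "w = u' @ c # d # v'" and cd: "reducible c d"
        and N: "normal_coeff t w = reduct (normal_coeff t) u' c d v'"
        using normal_coeff_some by blast
      have con: "(w', w) \<in> smaller \<Longrightarrow> consistent_at (normal_coeff t) w'" for w'
        by (rule less)
      have "reduct (normal_coeff t) u a b v = reduct (normal_coeff t) u' c d v'"
      proof (cases "length u \<le> length u'")
        case True
        show ?thesis
          by (rule reduct_confluent[OF _ ab cd con True]) (use w w' in auto)
      next
        case False
        then show ?thesis
          by (intro reduct_confluent[OF _ cd ab con, symmetric]) (use w w' in auto)
      qed
      then show "normal_coeff t w = reduct (normal_coeff t) u a b v"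
        using N by simp
    qed
  qed
  then show "reducible a b \<Longrightarrow> normal_coeff t (u @ a # b # v) = reduct (normal_coeff t) u a b v"
    by (rule consistent_atD)
qed

section \<open>Normal words and triangularity by weight\<close>

lemma normal_Cons: "normal_word (a # w) \<Longrightarrow> normal_word w"
  unfolding normal_word_def by (metis append_Cons)

lemma normal_head: "normal_word (a # b # w) \<Longrightarrow> \<not> reducible a b"
  unfolding normal_word_def by (metis append_Nil)

text \<open>Not being a descent is the lexicographic order of letters. It is transitive, so a
  condition on neighbours spreads to all pairs.\<close>

lemma normal_sorted:
  assumes "normal_word w"
  shows "sorted_wrt (\<lambda>a b. \<not> descent a b) w"
  using assms
proof (induction w)
  case (Cons a w)
  then have IH: "sorted_wrt (\<lambda>a b. \<not> descent a b) w"
    using normal_Cons by blast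
  show ?case
  proof (cases w)
    case (Cons b v)
    then have "\<not> descent a b"
      using normal_head \<open>normal_word (a # w)\<close> by (auto simp: reducible_def)
    then have "\<not> descent a c" if "\<not> descent b c" for c
      using that by (auto simp: descent_def)
    then show ?thesis
      using IH \<open>\<not> descent a b\<close> by (simp add: Cons)
  qed simp
qed simp

lemma descent_antisym: "\<not> descent a b \<Longrightarrow> \<not> descent b a \<Longrightarrow> a = b"
  by (auto simp: descent_def prod_eq_iff)

text \<open>Equal letters of a sorted word are adjacent, so a second copy of such a letter would
  create a null square.\<close>

lemma normal_count:
  assumes "normal_word w" "P (fst a) \<noteq> P (snd a)"
  shows "count (mset w) a \<le> 1"
  using assms(1)
proof (induction w)
  case (Cons c w)
  then have IH: "count (mset w) a \<le> 1"
    using normal_Cons by blast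
  show ?case
  proof (cases "c = a \<and> a \<in> set w")
    case True
    then obtain b v where w: "w = b # v"
      by (cases w) auto
    have "\<not> descent c b" "b = a \<or> \<not> descent b a"
      using normal_sorted[OF Cons.prems] True by (auto simp: w)
    then have "b = a"
      using True descent_antisym by blast
    then have "null_square c b"
      using True assms(2) by (simp add: null_square_def)
    then show ?thesis
      using normal_head Cons.prems by (simp add: w reducible_def)
  next
    case False
    then have "c = a \<Longrightarrow> count (mset w) a = 0"
      by (simp add: count_eq_zero_iff)
    then show ?thesis
      using IH by simp
  qed
qed simp

lemma normal_unique:
  assumes "normal_word t" "normal_word w" "mset t = mset w"
  shows "t = w"
proof -
  have "length t = length w"
    using assms(3) by (metis size_mset)
  then show ?thesis
    using normal_sorted[OF assms(1)] normal_sorted[OF assms(2)] assms(3)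
  proof (induction t w rule: list_induct2)
    case (Cons a t b w)
    have "a \<in># mset (b # w)" "b \<in># mset (a # t)"
      using Cons.prems(3) by (metis list.set_intros(1) set_mset_mset)+
    then have "a = b \<or> \<not> descent a b \<and> \<not> descent b a"
      using Cons.prems by auto
    then have "a = b"
      using descent_antisym by blast
    then show ?case
      using Cons by simp
  qed simp
qed

text \<open>Sorting by adjacent swaps, which terminates by \<open>smaller\<close>. The bound on the
  counts keeps null squares from appearing.\<close>

lemma normal_word_exists:
  assumes "\<And>a. P (fst a) \<noteq> P (snd a) \<Longrightarrow> count (mset w) a \<le> 1"
  shows "\<exists>t. normal_word t \<and> mset t = mset w"
  using wf_smaller assms
proof (induction w)
  case (less w)
  show ?case
  proof (cases "normal_word w")
    case False
    then obtain u a b v where w: "w = u @ a # b # v" and ab: "reducible a b"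
      unfolding normal_word_def by blast
    have mset: "mset (u @ b # a # v) = mset w"
      by (simp add: w add_mset_commute)
    have "\<not> null_square a b"
    proof
      assume sq: "null_square a b"
      then have "P (fst a) \<noteq> P (snd a)" "a = b"
        unfolding null_square_def by blast+
      then show False
        using less.prems[of a] by (simp add: w)
    qed
    then show ?thesis
      using less.IH[OF smaller_reducible(1)[OF ab, of u v, folded w]] less.prems mset by metis
  qed blast
qed

text \<open>A rewriting step produces the swapped word with an invertible coefficient and possibly a
  strictly lighter word. Hence the letters of \<open>w\<close> themselves lead to a unit, and every
  other contribution is lighter than \<open>w\<close>. The induction treats both claims at
  once.\<close>

lemma normal_coeff_triangular:
  assumes "normal_word t"
  shows "mset t \<noteq> mset w \<Longrightarrow> weight w \<le> weight t \<Longrightarrow> normal_coeff t w = 0"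
    and "mset t = mset w \<Longrightarrow> normal_coeff t w dvd 1"
proof -
  have "(mset t \<noteq> mset w \<longrightarrow> weight w \<le> weight t \<longrightarrow> normal_coeff t w = 0)
      \<and> (mset t = mset w \<longrightarrow> normal_coeff t w dvd 1)"
    using wf_smaller
  proof (induction w)
    case (less w)
    show ?case
    proof (cases "normal_word w")
      case True
      then show ?thesis
        using normal_unique[OF assms True] by (auto simp: normal_coeff_normal)
    next
      case False
      then obtain u a b v where w: "w = u @ a # b # v" and ab: "reducible a b"
        and N: "normal_coeff t w = reduct (normal_coeff t) u a b v"
        using normal_coeff_some by blast
      let ?w' = "u @ b # a # v" and ?w'' = "u @ (fst b, snd a) # (fst a, snd b) # v"
      have mset: "mset ?w' = mset w"
        by (simp add: w add_mset_commute)
      have weight: "weight ?w' = weight w"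
        by (rule weight_mset[OF mset])
      show ?thesis
      proof (cases "null_square a b")
        case True
        \<comment> \<open>The coefficient is zero here, so the claim about units must be vacuous:
          \<open>w\<close> repeats a letter that a normal word contains at most once.\<close>
        have "mset t \<noteq> mset w"
        proof
          assume "mset t = mset w"
          moreover have "P (fst a) \<noteq> P (snd a)"
            using True unfolding null_square_def by blast
          ultimately have "count (mset w) a \<le> 1"
            using normal_count[OF assms] by metis
          then show False
            using True by (simp add: w null_square_def)
        qed
        then show ?thesis
          using N True by (simp add: reduct_def)
      next
        case False
        note IH' = less[OF smaller_reducible(1)[OF ab False, of u v, folded w], unfolded mset weight]
        show ?thesis
        proof (cases "fst a = fst b")
          case True
          moreover have "Qinv (fst b) * normal_coeff t ?w' dvd 1" if "normal_coeff t ?w' dvd 1"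
            using mult_dvd_mono[OF _ that, of "Qinv (fst b)" 1] Q_Qinv[of "fst b"]
            by (metis dvd_triv_right mult.right_neutral)
          ultimately show ?thesis
            using N False IH' by (auto simp: reduct_def)
        next
          case rows: False
          then have less_row: "fst b < fst a"
            using ab False by (auto simp: reducible_def descent_def)
          \<comment> \<open>The exchange term is lighter than \<open>w\<close>, hence lighter than
            \<open>t\<close>; its letters then differ from those of \<open>t\<close>, and the
            induction hypothesis makes it vanish.\<close>
          have stay: "stay_coeff (snd a) (snd b) * normal_coeff t ?w'' = 0" if "weight w \<le> weight t"
          proof (cases "snd b < snd a")
            case True
            then have "weight ?w'' < weight w"
              using weight_exchange[OF less_row True, of u v] by (simp add: w)
            moreover have "mset t \<noteq> mset ?w''"
              using that \<open>weight ?w'' < weight w\<close> weight_mset[of t ?w''] by auto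
            ultimately have "normal_coeff t ?w'' = 0"
              using less[OF smaller_reducible(2)[OF ab False rows, of u v, folded w]] that by auto
            then show ?thesis
              by simp
          qed (simp add: stay_coeff_def)
          have "swap_coeff (snd a) (snd b) * normal_coeff t ?w' dvd 1" if "normal_coeff t ?w' dvd 1"
            using mult_dvd_mono[OF _ that, of "Qinv (snd a)" 1] Q_Qinv[of "snd a"] that
            by (simp add: swap_coeff_def) (metis dvd_triv_right mult.right_neutral)
          then show ?thesis
            using N False rows IH' stay weight_mset[of t w] by (auto simp: reduct_def)
        qed
      qed
    qed
  qed
  then show "mset t \<noteq> mset w \<Longrightarrow> weight w \<le> weight t \<Longrightarrow> normal_coeff t w = 0"
    and "mset t = mset w \<Longrightarrow> normal_coeff t w dvd 1"
    by auto
qed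

end

section \<open>The free algebra and functionals on its quotient\<close>

text \<open>Confining the supports to \<open>S\<close> turns this into an induction on the carrier
  of the free algebra, with \<open>S\<close> the set of words in the admissible letters.\<close>

lemma poly_mapping_induct_single:
  assumes zero: "P 0"
    and add: "\<And>f g. Poly_Mapping.keys f \<subseteq> S \<Longrightarrow> Poly_Mapping.keys g \<subseteq> S \<Longrightarrow> P f \<Longrightarrow> P g \<Longrightarrow> P (f + g)"
    and single: "\<And>k c. k \<in> S \<Longrightarrow> P (Poly_Mapping.single k c)"
    and supp: "Poly_Mapping.keys f \<subseteq> S"
  shows "P (f :: 'a \<Rightarrow>\<^sub>0 'b::comm_monoid_add)"
proof -
  have f: "f = (\<Sum>k\<in>Poly_Mapping.keys f. Poly_Mapping.single k (Poly_Mapping.lookup f k))"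
    by (rule poly_mapping_eqI) (auto simp: lookup_sum lookup_single when_def not_in_keys_iff_lookup_eq_zero)
  have "Poly_Mapping.keys (\<Sum>k\<in>K. Poly_Mapping.single k (Poly_Mapping.lookup f k)) \<subseteq> S \<and> P (\<Sum>k\<in>K. Poly_Mapping.single k (Poly_Mapping.lookup f k))"
    if "finite K" "K \<subseteq> S" for K
    using that
  proof (induction K rule: finite_induct)
    case (insert k K)
    then show ?case
      using add[OF _ _ single] keys_add[of "Poly_Mapping.single k (Poly_Mapping.lookup f k)" "\<Sum>k\<in>K. Poly_Mapping.single k (Poly_Mapping.lookup f k)"]
      by (auto split: if_splits)
  qed (simp add: zero)
  from this[OF finite_keys supp] f show ?thesis
    by simp
qed

text \<open>A common form for three maps: linear extension from words, the map from Laurent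
  polynomials to rational functions, and the evaluation of formal sums of pairs. They differ in the
  additive map \<open>h\<close> applied to coefficients.\<close>

definition weighted_sum :: "('b::zero \<Rightarrow> 'c::comm_ring_1) \<Rightarrow> ('a \<Rightarrow> 'c) \<Rightarrow> ('a \<Rightarrow>\<^sub>0 'b) \<Rightarrow> 'c" where
  "weighted_sum h \<phi> f = (\<Sum>k\<in>Poly_Mapping.keys f. h (Poly_Mapping.lookup f k) * \<phi> k)"

lemma weighted_sum_single: "h 0 = 0 \<Longrightarrow> weighted_sum h \<phi> (Poly_Mapping.single k c) = h c * \<phi> k"
  by (simp add: weighted_sum_def)

lemma weighted_sum_zero [simp]: "weighted_sum h \<phi> 0 = 0"
  by (simp add: weighted_sum_def)

lemma weighted_sum_add:
  assumes h: "h 0 = 0" "\<And>x y. h (x + y) = h x + h y"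
  shows "weighted_sum h \<phi> (f + g) = weighted_sum h \<phi> f + weighted_sum h \<phi> g"
proof -
  \<comment> \<open>Cancellation may shrink the support of the sum, so all three supports are
    enlarged to the union.\<close>
  have *: "weighted_sum h \<phi> f' = (\<Sum>k\<in>Poly_Mapping.keys f \<union> Poly_Mapping.keys g. h (Poly_Mapping.lookup f' k) * \<phi> k)"
    if "Poly_Mapping.keys f' \<subseteq> Poly_Mapping.keys f \<union> Poly_Mapping.keys g" for f'
    unfolding weighted_sum_def
    by (rule sum.mono_neutral_left) (use that h in \<open>auto simp: in_keys_iff\<close>)
  show ?thesis
    using *[OF keys_add] *[of f] *[of g]
    by (simp add: lookup_add h distrib_right sum.distrib)
qed

definition linear_ext :: "((nat \<times> nat) list \<Rightarrow> 'k::field laurent) \<Rightarrow> 'k free_alg \<Rightarrow> 'k laurent" where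
  "linear_ext \<phi> = weighted_sum (\<lambda>c. c) (\<lambda>w. \<phi> (letters w))"

definition word :: "(nat \<times> nat) list \<Rightarrow> 'k::field free_alg" where
  "word w = Poly_Mapping.single (Word w) 1"

lemma word_mult: "word u * word v = word (u @ v)"
  by (simp add: word_def mult_single plus_free_monoid_def)

lemma word_Nil: "word [] = 1"
  by (simp add: word_def flip: zero_free_monoid_def)

lemma free_gen_word: "free_gen i j = word [(i, j)]"
  by (simp add: free_gen_def word_def)

lemma scalar_word: "scalar c * word w = Poly_Mapping.single (Word w) c"
  by (simp add: scalar_def word_def mult_single)

lemma scalar_mult: "scalar (c * d) = scalar c * scalar d"
  by (simp add: scalar_def mult_single)

lemma scalar_add: "scalar (c + d) = scalar c + scalar d"
  by (simp add: scalar_def single_add)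

lemma scalar_uminus: "scalar (- c) = - scalar c"
  by (simp add: scalar_def single_uminus)

lemma scalar_1: "scalar 1 = 1"
  by (simp add: scalar_def)

lemma scalar_0: "scalar 0 = 0"
  by (simp add: scalar_def)

lemma free_alg_induct [case_names zero add single]:
  assumes "P 0" "\<And>f g. P f \<Longrightarrow> P g \<Longrightarrow> P (f + g)" "\<And>c w. P (scalar c * word w)"
  shows "P (f :: 'k::field free_alg)"
proof (rule poly_mapping_induct_single[of P UNIV])
  show "P (Poly_Mapping.single k c)" for k c
    using assms(3)[of c "letters k"] by (simp add: scalar_word)
qed (use assms in auto)

lemma scalar_commute: "f * scalar c = scalar c * f"
proof (induction f rule: free_alg_induct)
  case (single d w)
  show ?case
    by (simp add: scalar_word) (simp add: scalar_def mult_single mult.commute)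
qed (simp_all add: distrib_left distrib_right)

lemma scalar_left_commute: "f * (scalar c * g) = scalar c * (f * g)"
  using scalar_commute[of f c] by (simp flip: mult.assoc)

lemma linear_ext_add: "linear_ext \<phi> (f + g) = linear_ext \<phi> f + linear_ext \<phi> g"
  unfolding linear_ext_def by (rule weighted_sum_add) auto

lemma linear_ext_zero: "linear_ext \<phi> 0 = 0"
  by (simp add: linear_ext_def)

lemma linear_ext_single: "linear_ext \<phi> (Poly_Mapping.single w c) = c * \<phi> (letters w)"
  by (simp add: linear_ext_def weighted_sum_single)

lemma linear_ext_word: "linear_ext \<phi> (word w) = \<phi> w"
  by (simp add: word_def linear_ext_single)

lemma linear_ext_scalar: "linear_ext \<phi> (scalar c * f) = c * linear_ext \<phi> f"
proof (induction f rule: free_alg_induct)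
  case (single d w)
  have "scalar c * (scalar d * word w) = Poly_Mapping.single (Word w) (c * d)"
    by (simp add: scalar_word) (simp add: scalar_def mult_single)
  then show ?case
    by (simp add: scalar_word linear_ext_single)
qed (simp_all add: distrib_left linear_ext_add linear_ext_zero)

lemma linear_ext_uminus: "linear_ext \<phi> (- f) = - linear_ext \<phi> f"
  using linear_ext_scalar[of \<phi> "- 1" f] by (simp add: scalar_uminus scalar_1)

lemma linear_ext_diff: "linear_ext \<phi> (f - g) = linear_ext \<phi> f - linear_ext \<phi> g"
  using linear_ext_add[of \<phi> f "- g"] by (simp add: linear_ext_uminus)

lemma carrier_free_algebra: "f \<in> carrier (free_algebra n) \<longleftrightarrow> (\<forall>w\<in>Poly_Mapping.keys f. set (letters w) \<subseteq> generators n)"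
  by (simp add: free_algebra_def)

lemma free_algebra_simps [simp]:
  "f \<otimes>\<^bsub>free_algebra n\<^esub> g = f * g" "f \<oplus>\<^bsub>free_algebra n\<^esub> g = f + g"
  "\<one>\<^bsub>free_algebra n\<^esub> = 1" "\<zero>\<^bsub>free_algebra n\<^esub> = 0" "c \<odot>\<^bsub>free_algebra n\<^esub> f = scalar c * f"
  by (simp_all add: free_algebra_def)

lemma free_algebra_add_closed:
  "f \<in> carrier (free_algebra n) \<Longrightarrow> g \<in> carrier (free_algebra n) \<Longrightarrow> f + g \<in> carrier (free_algebra n)"
  using keys_add[of f g] by (auto simp: carrier_free_algebra)

lemma free_algebra_mult_closed:
  "f \<in> carrier (free_algebra n) \<Longrightarrow> g \<in> carrier (free_algebra n) \<Longrightarrow> f * g \<in> carrier (free_algebra n)"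
  using keys_mult[of f g] by (fastforce simp: carrier_free_algebra plus_free_monoid_def)

lemma scalar_closed: "scalar c \<in> carrier (free_algebra n)"
  by (simp add: carrier_free_algebra scalar_def zero_free_monoid_def)

lemma free_algebra_zero_closed: "0 \<in> carrier (free_algebra n)"
  by (simp add: carrier_free_algebra)

lemma free_algebra_uminus_closed: "f \<in> carrier (free_algebra n) \<Longrightarrow> - f \<in> carrier (free_algebra n)"
  by (simp add: carrier_free_algebra)

lemma word_closed: "set w \<subseteq> generators n \<Longrightarrow> word w \<in> carrier (free_algebra n)"
  by (simp add: carrier_free_algebra word_def)

lemma ring_free_algebra: "ring (free_algebra n)"
proof (rule ringI)
  show "abelian_group (free_algebra n)"
  proof (rule abelian_groupI)
    fix f assume f: "f \<in> carrier (free_algebra n)"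
    show "\<exists>g\<in>carrier (free_algebra n). g \<oplus>\<^bsub>free_algebra n\<^esub> f = \<zero>\<^bsub>free_algebra n\<^esub>"
      by (rule bexI[of _ "- f"]) (simp_all add: free_algebra_uminus_closed f)
  qed (simp_all add: free_algebra_add_closed algebra_simps, simp add: carrier_free_algebra)
  show "monoid (free_algebra n)"
    by (rule monoidI) (use scalar_closed[of 1] in \<open>simp_all add: free_algebra_mult_closed mult.assoc scalar_1\<close>)
qed (simp_all add: algebra_simps)

lemma a_inv_free_algebra:
  assumes "f \<in> carrier (free_algebra n)"
  shows "\<ominus>\<^bsub>free_algebra n\<^esub> f = - f"
proof -
  interpret ring "free_algebra n" by (rule ring_free_algebra)
  show ?thesis
    by (rule minus_equality) (use assms in \<open>simp_all add: free_algebra_uminus_closed\<close>)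
qed

lemma relations_closed: "(relations n p :: 'k::field free_alg set) \<subseteq> carrier (free_algebra n)"
proof -
  have gen: "(free_gen i j :: 'k free_alg) \<in> carrier (free_algebra n)" if "i \<in> {1..n}" "j \<in> {1..n}" for i j
    using that by (simp add: free_gen_word word_closed generators_def)
  have diff: "f - g \<in> carrier (free_algebra n)"
    if "f \<in> carrier (free_algebra n)" "g \<in> carrier (free_algebra n)" for f g :: "'k free_alg"
    using free_algebra_add_closed[OF that(1) free_algebra_uminus_closed[OF that(2)]] by simp
  note closed = gen diff free_algebra_add_closed free_algebra_mult_closed scalar_closed
  show ?thesis
  proof
    fix r :: "'k free_alg"
    assume "r \<in> relations n p"
    then show "r \<in> carrier (free_algebra n)"
      unfolding relations_def power2_eq_square
      by (elim UnE CollectE exE conjE) (simp_all only: closed)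
  qed
qed

lemma ideal_rel_ideal: "ideal (rel_ideal n p) (free_algebra n)"
  unfolding rel_ideal_def by (rule ring.genideal_ideal[OF ring_free_algebra relations_closed])

lemma relations_rel_ideal: "relations n p \<subseteq> rel_ideal n p"
  unfolding rel_ideal_def by (rule ring.genideal_self[OF ring_free_algebra relations_closed])

text \<open>A kernel of a functional is no ideal. The elements all of whose two-sided multiples are
  killed do form one, and it contains the relations because the functional vanishes on each relation
  between two words.\<close>

lemma linear_ext_rel_ideal:
  fixes \<phi> :: "(nat \<times> nat) list \<Rightarrow> 'k::field laurent"
  assumes rel: "\<And>u v r. r \<in> relations n p \<Longrightarrow> linear_ext \<phi> (word u * r * word v) = 0"
    and f: "f \<in> rel_ideal n p"
  shows "linear_ext \<phi> f = 0"
proof -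
  let ?A = "free_algebra n :: ('k laurent, 'k free_alg) module"
  let ?J = "{f \<in> carrier ?A. \<forall>g h. linear_ext \<phi> (g * f * h) = 0}"
  have "ideal ?J ?A"
  proof (rule idealI)
    show "subgroup ?J (add_monoid ?A)"
    proof (rule subgroup.intro)
      fix f assume "f \<in> ?J"
      then show "inv\<^bsub>add_monoid ?A\<^esub> f \<in> ?J"
        using a_inv_free_algebra[of f n]
        by (simp add: a_inv_def free_algebra_uminus_closed linear_ext_uminus)
    qed (auto simp: free_algebra_add_closed distrib_left distrib_right linear_ext_add linear_ext_zero
        free_algebra_zero_closed)
  next
    fix f g
    assume "f \<in> ?J" "g \<in> carrier ?A"
    then show "g \<otimes>\<^bsub>?A\<^esub> f \<in> ?J" "f \<otimes>\<^bsub>?A\<^esub> g \<in> ?J"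
      by (simp_all add: free_algebra_mult_closed mult.assoc) (metis mult.assoc)
  qed (rule ring_free_algebra)
  moreover have "relations n p \<subseteq> ?J"
  proof
    fix r :: "'k free_alg"
    assume r: "r \<in> relations n p"
    have "linear_ext \<phi> (g * r * h) = 0" for g h
    proof (induction g rule: free_alg_induct)
      case (single c u)
      show ?case
      proof (induction h rule: free_alg_induct)
        case (single d v)
        have "scalar c * word u * r * (scalar d * word v) = scalar c * (scalar d * (word u * r * word v))"
          by (simp only: mult.assoc scalar_left_commute[of r] scalar_left_commute[of "word u"])
        then show ?case
          using rel[OF r] by (simp add: linear_ext_scalar)
      qed (simp_all add: distrib_left linear_ext_add linear_ext_zero)
    qed (simp_all add: distrib_right linear_ext_add linear_ext_zero)
    then show "r \<in> ?J"
      using subsetD[OF relations_closed r] by simp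
  qed
  ultimately have "rel_ideal n p \<subseteq> ?J"
    unfolding rel_ideal_def by (rule ring.genideal_minimal[OF ring_free_algebra])
  then have "linear_ext \<phi> (1 * f * 1) = 0"
    using f by blast
  then show ?thesis
    by simp
qed

section \<open>The quotient as a module\<close>

lemma Fq_int_eq:
  "Fq_int n p = \<lparr>carrier = a_rcosets\<^bsub>free_algebra n\<^esub> (rel_ideal n p), monoid.mult = rcoset_mult (free_algebra n) (rel_ideal n p),
      one = rel_ideal n p +>\<^bsub>free_algebra n\<^esub> 1, ring.zero = rel_ideal n p, add = set_add (free_algebra n),
      smult = (\<lambda>c C. \<Union>f\<in>C. rel_ideal n p +>\<^bsub>free_algebra n\<^esub> (scalar c * f))\<rparr>"
  by (simp add: Fq_int_def FactRing_def ring.extend_def module.fields_def)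

definition coset :: "nat \<Rightarrow> (nat \<Rightarrow> bit) \<Rightarrow> 'k::field free_alg \<Rightarrow> 'k free_alg set" where
  "coset n p f = rel_ideal n p +>\<^bsub>free_algebra n\<^esub> f"

lemma carrier_Fq_int: "carrier (Fq_int n p) = coset n p ` carrier (free_algebra n)"
  by (auto simp: Fq_int_eq coset_def A_RCOSETS_def' a_r_coset_def')

lemma coset_eq_iff:
  assumes "f \<in> carrier (free_algebra n)" "g \<in> carrier (free_algebra n)"
  shows "coset n p f = coset n p g \<longleftrightarrow> f - g \<in> rel_ideal n p"
proof -
  have "f \<ominus>\<^bsub>free_algebra n\<^esub> g = f - g"
    using assms by (simp add: a_minus_def a_inv_free_algebra)
  then show ?thesis
    unfolding coset_def
    using ring.quotient_eq_iff_same_a_r_cos[OF ring_free_algebra ideal_rel_ideal assms] by simp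
qed

lemma coset_add:
  assumes "f \<in> carrier (free_algebra n)" "g \<in> carrier (free_algebra n)"
  shows "coset n p f \<oplus>\<^bsub>Fq_int n p\<^esub> coset n p g = coset n p (f + g)"
  using ideal.a_rcos_sum[OF ideal_rel_ideal assms] by (simp add: Fq_int_eq coset_def)

lemma coset_mult:
  assumes "f \<in> carrier (free_algebra n)" "g \<in> carrier (free_algebra n)"
  shows "coset n p f \<otimes>\<^bsub>Fq_int n p\<^esub> coset n p g = coset n p (f * g)"
  using ideal.rcoset_mult_add[OF ideal_rel_ideal assms] by (simp add: Fq_int_eq coset_def)

lemma rel_ideal_closed: "f \<in> rel_ideal n p \<Longrightarrow> f \<in> carrier (free_algebra n)"
  using ideal.Icarr[OF ideal_rel_ideal] .

lemma rel_ideal_mult: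
  "f \<in> rel_ideal n p \<Longrightarrow> g \<in> carrier (free_algebra n) \<Longrightarrow> g * f \<in> rel_ideal n p"
  "f \<in> rel_ideal n p \<Longrightarrow> g \<in> carrier (free_algebra n) \<Longrightarrow> f * g \<in> rel_ideal n p"
  using ideal.I_l_closed[OF ideal_rel_ideal, of f n p g] ideal.I_r_closed[OF ideal_rel_ideal, of f n p g]
  by simp_all

lemma mem_coset: "f \<in> carrier (free_algebra n) \<Longrightarrow> f \<in> coset n p f"
  using additive_subgroup.zero_closed[OF ideal.axioms(1)[OF ideal_rel_ideal], of n p]
  by (force simp: coset_def a_r_coset_def')

text \<open>The scalar action on the quotient is a union over all representatives. It collapses to
  one coset because the ideal absorbs multiplication by scalars.\<close>

lemma coset_smult:
  assumes f: "f \<in> carrier (free_algebra n)"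
  shows "c \<odot>\<^bsub>Fq_int n p\<^esub> coset n p f = coset n p (scalar c * f)"
proof -
  have "coset n p (scalar c * g) = coset n p (scalar c * f)" if g: "g \<in> coset n p f" for g
  proof -
    obtain h where h: "h \<in> rel_ideal n p" "g = h + f"
      using g by (auto simp: coset_def a_r_coset_def')
    then have "g \<in> carrier (free_algebra n)"
      using f by (simp add: free_algebra_add_closed rel_ideal_closed)
    moreover have "scalar c * g - scalar c * f = scalar c * h"
      by (simp add: h distrib_left)
    ultimately show ?thesis
      using f h by (simp add: coset_eq_iff free_algebra_mult_closed scalar_closed rel_ideal_mult)
  qed
  then have "(\<Union>g\<in>coset n p f. coset n p (scalar c * g)) = (\<Union>g\<in>coset n p f. coset n p (scalar c * f))"
    by (intro SUP_cong) simp_all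
  also have "\<dots> = coset n p (scalar c * f)"
    using mem_coset[OF f] by blast
  finally show ?thesis
    by (simp add: Fq_int_eq coset_def)
qed

lemma Fq_int_one: "\<one>\<^bsub>Fq_int n p\<^esub> = coset n p 1"
  by (simp add: Fq_int_eq coset_def)

lemma Fq_int_zero: "\<zero>\<^bsub>Fq_int n p\<^esub> = coset n p (0 :: 'k::field free_alg)"
proof -
  have "(rel_ideal n p :: 'k free_alg set) +>\<^bsub>free_algebra n\<^esub> 0 = rel_ideal n p"
    using ring.a_rcos_zero[OF ring_free_algebra ideal_rel_ideal, of 0 n p]
      additive_subgroup.zero_closed[OF ideal.axioms(1)[OF ideal_rel_ideal], of n p] by simp
  then show ?thesis
    by (simp add: Fq_int_eq coset_def)
qed

lemma module_Fq_int: "Module.module class_ring (Fq_int n p :: ('k::field laurent, 'k free_alg set) module)"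
proof -
  note closed = free_algebra_add_closed free_algebra_mult_closed scalar_closed free_algebra_zero_closed
    free_algebra_uminus_closed
  show ?thesis
  proof (rule Module.moduleI)
    show "cring (class_ring :: 'k laurent ring)"
      by (rule class_cring.is_cring)
    show "abelian_group (Fq_int n p)"
    proof (rule abelian_groupI)
      fix x assume "x \<in> carrier (Fq_int n p)"
      then obtain f where f: "f \<in> carrier (free_algebra n)" "x = coset n p f"
        by (auto simp: carrier_Fq_int)
      then show "\<exists>y\<in>carrier (Fq_int n p). y \<oplus>\<^bsub>Fq_int n p\<^esub> x = \<zero>\<^bsub>Fq_int n p\<^esub>"
        by (intro bexI[of _ "coset n p (- f)"])
          (auto simp: carrier_Fq_int coset_add Fq_int_zero closed)
    qed (auto simp: carrier_Fq_int coset_add Fq_int_zero closed algebra_simps)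
  qed (auto simp: carrier_Fq_int coset_add coset_smult closed scalar_add scalar_mult scalar_1 algebra_simps)
qed

section \<open>Removing the signs\<close>

lemma bit_sign_add: "bit_sign (x + y) = bit_sign x * bit_sign y"
  by (cases x; cases y) (simp_all add: bit_sign_def)

lemma bit_sign_square: "bit_sign x * bit_sign x = 1" "bit_sign x * (bit_sign x * t) = t"
  by (cases x; simp add: bit_sign_def)+

text \<open>Up to the factors that depend only on equality of indices, the sign \<open>par a * par b\<close> of the relations is
  \<open>swap_sign a b + swap_sign b a\<close>.  The summand \<open>p (fst a) * p (snd a)\<close> of the twist rescales the
  generators, so that the cross term carries no sign either.\<close>

definition swap_sign :: "(nat \<Rightarrow> bit) \<Rightarrow> nat \<times> nat \<Rightarrow> nat \<times> nat \<Rightarrow> bit" where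
  "swap_sign p a b = p (snd a) * p (fst b) + (if fst a < fst b then p (fst a) * p (fst b) else 0)
    + (if snd a < snd b then p (snd a) * p (snd b) else 0)"

fun twist :: "(nat \<Rightarrow> bit) \<Rightarrow> (nat \<times> nat) list \<Rightarrow> bit" where
  "twist p [] = 0"
| "twist p (a # w) = p (fst a) * p (snd a) + (\<Sum>b\<leftarrow>w. swap_sign p a b) + twist p w"

text \<open>Signs are added in characteristic two, so adding \<open>twist p [a, b]\<close> once more
  removes the inner contribution of the pair.\<close>

lemma twist_two:
  "twist p (a # b # v) + twist p [a, b] = (\<Sum>y\<leftarrow>v. swap_sign p a y) + (\<Sum>y\<leftarrow>v. swap_sign p b y) + twist p v"
proof -
  have "x + (s + A) + (y + B + t) + (x + (s + 0) + (y + 0 + 0)) = A + B + t" for x y s t A B :: bit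
    by (cases x; cases y; cases s; cases t; cases A; cases B) simp_all
  then show ?thesis
    by (simp only: twist.simps list.map sum_list.Cons sum_list.Nil)
qed

lemma twist_context:
  assumes "\<And>x. swap_sign p x a + swap_sign p x b = swap_sign p x c + swap_sign p x d"
    and "\<And>y. swap_sign p a y + swap_sign p b y = swap_sign p c y + swap_sign p d y"
  shows "twist p (u @ a # b # v) + twist p [a, b] = twist p (u @ c # d # v) + twist p [c, d]"
proof (induction u)
  case Nil
  have "(\<Sum>y\<leftarrow>v. swap_sign p a y) + (\<Sum>y\<leftarrow>v. swap_sign p b y)
      = (\<Sum>y\<leftarrow>v. swap_sign p c y) + (\<Sum>y\<leftarrow>v. swap_sign p d y)"
    unfolding sum_list_addf[symmetric] by (simp only: assms(2))
  then show ?case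
    by (simp only: append.simps twist_two)
next
  case (Cons x u)
  have "twist p ((x # u) @ a # b # v) + twist p [a, b]
      = p (fst x) * p (snd x) + (\<Sum>y\<leftarrow>u. swap_sign p x y) + (\<Sum>y\<leftarrow>v. swap_sign p x y)
        + (swap_sign p x a + swap_sign p x b) + (twist p (u @ a # b # v) + twist p [a, b])"
    by (simp only: append.simps twist.simps map_append sum_list.append list.map sum_list.Cons add_ac)
  also have "\<dots> = p (fst x) * p (snd x) + (\<Sum>y\<leftarrow>u. swap_sign p x y) + (\<Sum>y\<leftarrow>v. swap_sign p x y)
        + (swap_sign p x c + swap_sign p x d) + (twist p (u @ c # d # v) + twist p [c, d])"
    by (simp only: assms(1) Cons.IH)
  also have "\<dots> = twist p ((x # u) @ c # d # v) + twist p [c, d]"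
    by (simp only: append.simps twist.simps map_append sum_list.append list.map sum_list.Cons add_ac)
  finally show ?case .
qed

text \<open>In each argument \<open>swap_sign\<close> is a sum of a row term and a column term.
  Letters outside therefore cannot distinguish the two orders of the pair or the exchange of its
  columns, and \<open>T\<close> is their common contribution.\<close>

lemma twist_split:
  "\<exists>T. twist p (u @ (i, j) # (h, k) # v) = T + twist p [(i, j), (h, k)]
    \<and> twist p (u @ (h, k) # (i, j) # v) = T + twist p [(h, k), (i, j)]
    \<and> twist p (u @ (i, k) # (h, j) # v) = T + twist p [(i, k), (h, j)]"
proof -
  let ?T = "twist p (u @ (i, j) # (h, k) # v) + twist p [(i, j), (h, k)]"
  have "?T = twist p (u @ (h, k) # (i, j) # v) + twist p [(h, k), (i, j)]"
    by (rule twist_context) (rule add.commute)+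
  moreover have "?T = twist p (u @ (i, k) # (h, j) # v) + twist p [(i, k), (h, j)]"
    by (rule twist_context) (simp_all only: swap_sign_def fst_conv snd_conv add_ac)
  moreover have "x + y + y = x" for x y :: bit
    by (cases x; cases y) auto
  ultimately show ?thesis
    by metis
qed

lemma quantum_parameters_laurent:
  "quantum_parameters (Poly_Mapping.single 1 1 :: 'k::field laurent) (Poly_Mapping.single (- 1) 1)"
  by standard (simp add: mult_single)

abbreviation laurent_coeff :: "(nat \<Rightarrow> bit) \<Rightarrow> (nat \<times> nat) list \<Rightarrow> (nat \<times> nat) list \<Rightarrow> 'k::field laurent" where
  "laurent_coeff p \<equiv> quantum_parameters.normal_coeff (Poly_Mapping.single 1 1) (Poly_Mapping.single (- 1) 1) (\<lambda>i. p i = 1)"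

definition twisted_coeff :: "(nat \<Rightarrow> bit) \<Rightarrow> (nat \<times> nat) list \<Rightarrow> (nat \<times> nat) list \<Rightarrow> 'k::field laurent" where
  "twisted_coeff p t w = bit_sign (twist p w) * laurent_coeff p t w"

lemma sign_exchange:
  fixes A B C T :: "'a::comm_ring_1"
  assumes "A * B = C"
  shows "A * (T * B * x) = T * C * x"
  by (simp add: mult_ac flip: assms)

lemma sign_exchange_unit:
  fixes A B C T q Q Q' :: "'a::comm_ring_1"
  assumes "A * B * q = C * Q" "Q * Q' = 1"
  shows "A * q * (T * B * (Q' * x)) = T * C * x"
proof -
  have "A * q * (T * B * (Q' * x)) = T * (A * B * q) * Q' * x"
    by (simp only: mult_ac)
  also have "\<dots> = T * C * (Q * Q') * x"
    unfolding assms(1) by (simp only: mult_ac)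
  finally show ?thesis
    by (simp only: assms(2) mult.right_neutral)
qed

text \<open>For each relation of two terms or more, \<open>twist_split\<close> removes the context
  and one reduction step of \<open>normal_coeff\<close> removes the monomials. What remains is an
  identity between signs of two-letter words, checked over all parities.\<close>

lemma twisted_coeff_relations:
  fixes r :: "'k::field free_alg"
  assumes "r \<in> relations n p"
  shows "linear_ext (twisted_coeff p t) (word u * r * word v) = 0"
proof -
  interpret quantum_parameters "Poly_Mapping.single 1 1 :: 'k laurent" "Poly_Mapping.single (- 1) 1" "\<lambda>i. p i = 1"
    by (rule quantum_parameters_laurent)
  let ?N = "normal_coeff t"
  let ?c = "twisted_coeff p t :: _ \<Rightarrow> 'k laurent"
  \<comment> \<open>For odd \<open>p i\<close> the sign turns the parameter q^-1 into the root -
    q^-1. The same sign makes the coefficient of the exchange term independent of the row.\<close>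
  have Q: "Q i = bit_sign (p i) * qs p i" "qs p i - qs_inv p i = bit_sign (p i) * (lam :: 'k laurent)" for i
    by (cases "p i"; simp add: Q_def lam_def qs_def qs_inv_def bit_sign_def single_uminus)+
  have word_sandwich: "word u * (word x * word y) * word v = (word (u @ x @ y @ v) :: 'k free_alg)" for x y
    by (simp add: word_mult)
  have sandwich: "word u * (f - g) * word v = word u * f * word v - word u * g * word v"
    "word u * (f + g) * word v = word u * f * word v + word u * g * word v"
    "word u * (scalar c * f) * word v = scalar c * (word u * f * word v)" for f g :: "'k free_alg" and c
    by (simp_all add: algebra_simps scalar_left_commute)
  note expand = sandwich word_sandwich free_gen_word linear_ext_add linear_ext_diff linear_ext_scalar linear_ext_word
  note bits = swap_sign_def par_def bit_sign_def
  consider (square) i j where "r = free_gen i j ^ 2" "par p i j = 1"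
    | (row) i j k where "r = free_gen i j * free_gen i k - scalar (bit_sign (par p i j * par p i k) * qs p i) * (free_gen i k * free_gen i j)" "j < k"
    | (col) i h j where "r = free_gen i j * free_gen h j - scalar (bit_sign (par p i j * par p h j) * qs p j) * (free_gen h j * free_gen i j)" "i < h"
    | (comm) i j h k where "r = free_gen i j * free_gen h k - scalar (bit_sign (par p i j * par p h k)) * (free_gen h k * free_gen i j)" "i < h" "k < j"
    | (cross) i j h k where "r = free_gen i j * free_gen h k
       - (scalar (bit_sign (par p i j * par p h k)) * (free_gen h k * free_gen i j)
          + scalar (bit_sign (par p i j * par p i k) * (qs p i - qs_inv p i)) * (free_gen i k * free_gen h j))" "i < h" "j < k"
    using assms unfolding relations_def by (elim UnE CollectE exE conjE) metis+
  then show ?thesis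
  proof cases
    case square
    have "null_square (i, j) (i, j)"
      using square(2) by (cases "p i"; cases "p j") (simp_all add: null_square_def par_def)
    then show ?thesis
      using normal_coeff_reduct[of "(i, j)" "(i, j)" t u v]
      by (simp add: square power2_eq_square expand twisted_coeff_def reducible_def reduct_def)
  next
    case row
    obtain T where T: "twist p (u @ (i, j) # (i, k) # v) = T + twist p [(i, j), (i, k)]"
        "twist p (u @ (i, k) # (i, j) # v) = T + twist p [(i, k), (i, j)]"
      using twist_split by blast
    have N: "?N (u @ (i, k) # (i, j) # v) = Qinv i * ?N (u @ (i, j) # (i, k) # v)"
      using normal_coeff_reduct[of "(i, k)" "(i, j)" t u v] row(2)
      by (simp add: reducible_def descent_def reduct_def null_square_def)
    have "bit_sign (par p i j * par p i k) * bit_sign (twist p [(i, k), (i, j)]) * qs p i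
        = bit_sign (twist p [(i, j), (i, k)]) * (Q i :: 'k laurent)"
      unfolding Q using row(2) by (cases "p i"; cases "p j"; cases "p k") (simp_all add: bits)
    then have "bit_sign (par p i j * par p i k) * qs p i * ?c (u @ (i, k) # (i, j) # v) = ?c (u @ (i, j) # (i, k) # v)"
      unfolding twisted_coeff_def T N bit_sign_add using Q_Qinv by (rule sign_exchange_unit)
    then show ?thesis
      by (simp add: row expand)
  next
    case col
    obtain T where T: "twist p (u @ (i, j) # (h, j) # v) = T + twist p [(i, j), (h, j)]"
        "twist p (u @ (h, j) # (i, j) # v) = T + twist p [(h, j), (i, j)]"
      using twist_split by blast
    have N: "?N (u @ (h, j) # (i, j) # v) = Qinv j * ?N (u @ (i, j) # (h, j) # v)"
      using normal_coeff_reduct[of "(h, j)" "(i, j)" t u v] col(2)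
      by (simp add: reducible_def descent_def reduct_row swap_coeff_def stay_coeff_def)
    have "bit_sign (par p i j * par p h j) * bit_sign (twist p [(h, j), (i, j)]) * qs p j
        = bit_sign (twist p [(i, j), (h, j)]) * (Q j :: 'k laurent)"
      unfolding Q using col(2) by (cases "p i"; cases "p j"; cases "p h") (simp_all add: bits)
    then have "bit_sign (par p i j * par p h j) * qs p j * ?c (u @ (h, j) # (i, j) # v) = ?c (u @ (i, j) # (h, j) # v)"
      unfolding twisted_coeff_def T N bit_sign_add using Q_Qinv by (rule sign_exchange_unit)
    then show ?thesis
      by (simp add: col expand)
  next
    case comm
    obtain T where T: "twist p (u @ (i, j) # (h, k) # v) = T + twist p [(i, j), (h, k)]"
        "twist p (u @ (h, k) # (i, j) # v) = T + twist p [(h, k), (i, j)]"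
      using twist_split by blast
    have N: "?N (u @ (h, k) # (i, j) # v) = ?N (u @ (i, j) # (h, k) # v)"
      using normal_coeff_reduct[of "(h, k)" "(i, j)" t u v] comm(2,3)
      by (simp add: reducible_def descent_def reduct_row swap_coeff_def stay_coeff_def)
    have "bit_sign (par p i j * par p h k) * bit_sign (twist p [(h, k), (i, j)])
        = (bit_sign (twist p [(i, j), (h, k)]) :: 'k laurent)"
      using comm(2,3) by (cases "p i"; cases "p j"; cases "p h"; cases "p k") (simp_all add: bits)
    then have "bit_sign (par p i j * par p h k) * ?c (u @ (h, k) # (i, j) # v) = ?c (u @ (i, j) # (h, k) # v)"
      unfolding twisted_coeff_def T N bit_sign_add by (rule sign_exchange)
    then show ?thesis
      by (simp add: comm expand)
  next
    case cross
    obtain T where T: "twist p (u @ (i, j) # (h, k) # v) = T + twist p [(i, j), (h, k)]"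
        "twist p (u @ (h, k) # (i, j) # v) = T + twist p [(h, k), (i, j)]"
        "twist p (u @ (i, k) # (h, j) # v) = T + twist p [(i, k), (h, j)]"
      using twist_split by blast
    have N: "?N (u @ (h, k) # (i, j) # v) = ?N (u @ (i, j) # (h, k) # v) - lam * ?N (u @ (i, k) # (h, j) # v)"
      using normal_coeff_reduct[of "(h, k)" "(i, j)" t u v] cross(2,3)
      by (simp add: reducible_def descent_def reduct_row swap_coeff_def stay_coeff_def)
    define s where "s = (bit_sign (T + twist p [(i, j), (h, k)]) :: 'k laurent)"
    have key1: "bit_sign (par p i j * par p h k) * bit_sign (twist p [(h, k), (i, j)])
        = (bit_sign (twist p [(i, j), (h, k)]) :: 'k laurent)"
      using cross(2,3) by (cases "p i"; cases "p j"; cases "p h"; cases "p k") (simp_all add: bits)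
    have s1: "bit_sign (par p i j * par p h k) * bit_sign (T + twist p [(h, k), (i, j)]) = s"
      unfolding s_def bit_sign_add key1[symmetric] by (rule mult.left_commute)
    have key2: "bit_sign (par p i j * par p i k) * bit_sign (p i) * bit_sign (twist p [(i, k), (h, j)])
        = (bit_sign (twist p [(i, j), (h, k)]) :: 'k laurent)"
      using cross(2,3) by (cases "p i"; cases "p j"; cases "p h"; cases "p k") (simp_all add: bits)
    have s2: "bit_sign (par p i j * par p i k) * bit_sign (p i) * bit_sign (T + twist p [(i, k), (h, j)]) = s"
      unfolding s_def bit_sign_add key2[symmetric] by (rule mult.left_commute)
    have "bit_sign (par p i j * par p h k) * ?c (u @ (h, k) # (i, j) # v)
        = s * (?N (u @ (i, j) # (h, k) # v) - lam * ?N (u @ (i, k) # (h, j) # v))"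
      unfolding twisted_coeff_def T N by (simp only: s1 flip: mult.assoc)
    moreover have "bit_sign (par p i j * par p i k) * (qs p i - qs_inv p i) * ?c (u @ (i, k) # (h, j) # v)
        = (bit_sign (par p i j * par p i k) * bit_sign (p i) * bit_sign (T + twist p [(i, k), (h, j)]))
          * (lam * ?N (u @ (i, k) # (h, j) # v))"
      unfolding twisted_coeff_def T Q by (simp only: mult_ac)
    moreover have "?c (u @ (i, j) # (h, k) # v) = s * ?N (u @ (i, j) # (h, k) # v)"
      unfolding twisted_coeff_def T s_def ..
    moreover have "linear_ext (twisted_coeff p t) (word u * r * word v) = ?c (u @ (i, j) # (h, k) # v)
        - (bit_sign (par p i j * par p h k) * ?c (u @ (h, k) # (i, j) # v)
          + bit_sign (par p i j * par p i k) * (qs p i - qs_inv p i) * ?c (u @ (i, k) # (h, j) # v))"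
      by (simp only: cross(1) expand append.simps)
    ultimately show ?thesis
      by (simp only: s2 right_diff_distrib) (simp only: diff_add_cancel diff_self)
  qed
qed

section \<open>Ordered monomials for an arbitrary order\<close>

text \<open>In a vanishing combination choose an index of maximal weight among the nonzero
  coefficients: its functional sees that term alone, with a unit. Units are all that is required of
  the diagonal, so the lemma serves both ground rings.\<close>

lemma triangular_functionals_independent:
  fixes M :: "('c::comm_ring_1, 'm) module" and wt :: "'i \<Rightarrow> nat"
  assumes mod: "Module.module class_ring M" and v: "v ` I \<subseteq> carrier M"
    and add: "\<And>t x y. t \<in> I \<Longrightarrow> x \<in> carrier M \<Longrightarrow> y \<in> carrier M \<Longrightarrow> \<phi> t (x \<oplus>\<^bsub>M\<^esub> y) = \<phi> t x + \<phi> t y"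
    and smult: "\<And>t c x. t \<in> I \<Longrightarrow> x \<in> carrier M \<Longrightarrow> \<phi> t (c \<odot>\<^bsub>M\<^esub> x) = c * \<phi> t x"
    and unit: "\<And>t. t \<in> I \<Longrightarrow> \<phi> t (v t) dvd 1"
    and tri: "\<And>t e. t \<in> I \<Longrightarrow> e \<in> I \<Longrightarrow> t \<noteq> e \<Longrightarrow> wt e \<le> wt t \<Longrightarrow> \<phi> t (v e) = 0"
  shows "inj_on v I" and "\<not> LinearCombinations.module.lin_dep class_ring M (v ` I)"
proof -
  interpret M: Module.module "class_ring :: 'c ring" M by (rule mod)
  show inj: "inj_on v I"
  proof (rule inj_onI, rule ccontr)
    fix t e assume te: "t \<in> I" "e \<in> I" "v t = v e" "t \<noteq> e"
    have "\<phi> t (v t) = 0 \<or> \<phi> e (v e) = 0"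
      using tri[of t e] tri[of e t] te by (cases "wt e \<le> wt t") auto
    then show False
      using unit te by (metis dvd_0_left_iff zero_neq_one)
  qed
  have \<phi>0: "\<phi> t \<zero>\<^bsub>M\<^esub> = 0" if "t \<in> I" for t
    using add[OF that M.M.zero_closed M.M.zero_closed] by simp
  have \<phi>_sum: "\<phi> t (finsum M (\<lambda>w. a w \<odot>\<^bsub>M\<^esub> w) A) = (\<Sum>w\<in>A. a w * \<phi> t w)"
    if "finite A" "A \<subseteq> carrier M" "t \<in> I" for a A t
    using that
  proof (induction A rule: finite_induct)
    case (insert w A)
    then have "finsum M (\<lambda>w. a w \<odot>\<^bsub>M\<^esub> w) (insert w A) = a w \<odot>\<^bsub>M\<^esub> w \<oplus>\<^bsub>M\<^esub> finsum M (\<lambda>w. a w \<odot>\<^bsub>M\<^esub> w) A"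
      by (intro M.M.finsum_insert) (auto intro!: M.smult_closed)
    moreover have "finsum M (\<lambda>w. a w \<odot>\<^bsub>M\<^esub> w) A \<in> carrier M"
      using insert by (intro M.M.finsum_closed) (auto intro!: M.smult_closed)
    moreover have "a w \<odot>\<^bsub>M\<^esub> w \<in> carrier M"
      using insert by (auto intro!: M.smult_closed)
    ultimately show ?case
      using insert by (simp add: add smult)
  qed (simp add: \<phi>0)
  show "\<not> M.lin_dep (v ` I)"
  proof
    assume "M.lin_dep (v ` I)"
    then obtain A a w0 where A: "finite A" "A \<subseteq> v ` I" "M.lincomb a A = \<zero>\<^bsub>M\<^esub>" and w0: "w0 \<in> A" "a w0 \<noteq> 0"
      unfolding M.lin_dep_def by auto
    define T where "T = {t \<in> I. v t \<in> A \<and> a (v t) \<noteq> 0}"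
    have "finite T"
      by (rule finite_imageD[of v]) (use A inj in \<open>auto simp: T_def intro: finite_subset inj_on_subset\<close>)
    moreover have "T \<noteq> {}"
      using w0 A by (auto simp: T_def)
    ultimately have "Max (wt ` T) \<in> wt ` T"
      by (intro Max_in) auto
    then obtain t where t: "t \<in> T" "wt t = Max (wt ` T)"
      by force
    then have t_max: "\<And>e. e \<in> T \<Longrightarrow> wt e \<le> wt t"
      using \<open>finite T\<close> by simp
    have tI: "t \<in> I"
      using t by (simp add: T_def)
    have "0 = \<phi> t (M.lincomb a A)"
      using A \<phi>0 tI by simp
    also have "\<dots> = (\<Sum>w\<in>A. a w * \<phi> t w)"
      unfolding M.lincomb_def using A v by (intro \<phi>_sum tI) auto
    also have "\<dots> = (\<Sum>w\<in>{v t}. a w * \<phi> t w)"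
    proof (rule sum.mono_neutral_right[OF A(1)])
      show "{v t} \<subseteq> A"
        using t by (simp add: T_def)
      show "\<forall>w\<in>A - {v t}. a w * \<phi> t w = 0"
      proof
        fix w assume w: "w \<in> A - {v t}"
        then obtain e where e: "e \<in> I" "w = v e"
          using A by auto
        show "a w * \<phi> t w = 0"
        proof (cases "a w = 0")
          case False
          then have "e \<in> T"
            using w e by (simp add: T_def)
          moreover have "t \<noteq> e"
            using w e by auto
          ultimately show ?thesis
            using tri[OF tI e(1)] t_max[of e] e by simp
        qed simp
      qed
    qed
    finally have "a (v t) * \<phi> t (v t) = 0"
      by simp
    moreover obtain c where "1 = \<phi> t (v t) * c"
      using unit[OF tI] by (auto elim: dvdE)
    ultimately have "a (v t) = 0"
      by (metis mult.assoc mult.right_neutral mult_zero_left)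
    then show False
      using t by (simp add: T_def)
  qed
qed

text \<open>The description by \<open>THE\<close> must be shown to be met exactly once. Counting the
  predecessors of a generator turns the given order into a numerical key, for which existence is
  \<open>sort_key\<close> and uniqueness is that of sorted distinct lists.\<close>

lemma ordered_generators:
  assumes "linear_order_on (generators n) r"
  shows "set (ordered_generators n r) = generators n" "distinct (ordered_generators n r)"
proof -
  let ?A = "generators n"
  define rank where "rank g = card {h \<in> ?A. (h, g) \<in> r}" for g
  have fin: "finite ?A"
    by (simp add: generators_def)
  have refl: "refl_on ?A r" and trans: "trans r" and antisym: "antisym r" and tot: "total_on ?A r"
    using assms by (auto simp: linear_order_on_def partial_order_on_def preorder_on_def)
  have mono: "rank g \<le> rank h" if "(g, h) \<in> r" for g h
    unfolding rank_def by (rule card_mono) (use fin that trans in \<open>auto dest: transD\<close>)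
  have strict: "rank g < rank h" if "(g, h) \<in> r" "g \<noteq> h" "g \<in> ?A" "h \<in> ?A" for g h
    unfolding rank_def
  proof (rule psubset_card_mono)
    have "(h, g) \<notin> r"
      using that antisym by (auto dest: antisymD)
    moreover have "(h, h) \<in> r"
      using that refl by (auto dest: refl_onD)
    ultimately have "h \<in> {x \<in> ?A. (x, h) \<in> r} - {x \<in> ?A. (x, g) \<in> r}"
      using that by simp
    moreover have "{x \<in> ?A. (x, g) \<in> r} \<subseteq> {x \<in> ?A. (x, h) \<in> r}"
      using that trans by (auto dest: transD)
    ultimately show "{x \<in> ?A. (x, g) \<in> r} \<subset> {x \<in> ?A. (x, h) \<in> r}"
      by blast
  qed (use fin in simp)
  have total: "(g, h) \<in> r" if "rank g \<le> rank h" "g \<in> ?A" "h \<in> ?A" for g h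
  proof (rule ccontr)
    assume "(g, h) \<notin> r"
    then have "g \<noteq> h"
      using that refl by (auto dest: refl_onD)
    then have "(h, g) \<in> r"
      using that tot \<open>(g, h) \<notin> r\<close> by (auto simp: total_on_def)
    then show False
      using strict[of h g] that \<open>g \<noteq> h\<close> by simp
  qed
  have inj: "inj_on rank ?A"
    by (intro inj_onI antisymD[OF antisym] total) simp_all
  let ?Q = "\<lambda>gs. set gs = ?A \<and> distinct gs \<and> sorted_wrt (\<lambda>g h. (g, h) \<in> r) gs"
  obtain xs where xs: "set xs = ?A" "distinct xs"
    using finite_distinct_list[OF fin] by blast
  have "?Q (sort_key rank xs)"
  proof (intro conjI)
    have "sorted (map rank (sort_key rank xs))"
      by simp
    then have "sorted_wrt (\<lambda>g h. rank g \<le> rank h) (sort_key rank xs)"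
      by (simp add: sorted_wrt_map)
    then show "sorted_wrt (\<lambda>g h. (g, h) \<in> r) (sort_key rank xs)"
      by (rule sorted_wrt_mono_rel[rotated]) (use total xs in auto)
  qed (use xs in auto)
  moreover have "gs = hs" if "?Q gs" "?Q hs" for gs hs
  proof -
    have "sorted (map rank gs)" "distinct (map rank gs)" if "?Q gs" for gs
      using that mono inj by (auto simp: sorted_wrt_map distinct_map elim: sorted_wrt_mono_rel[rotated])
    then have "map rank gs = map rank hs"
      using that by (intro sorted_distinct_set_unique) auto
    then show ?thesis
      using that inj by (metis map_inj_on Un_absorb)
  qed
  ultimately have "\<exists>!gs. ?Q gs"
    by (intro ex1I[of ?Q "sort_key rank xs"]) blast+
  then have "?Q (ordered_generators n r)"
    unfolding ordered_generators_def by (rule theI')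
  then show "set (ordered_generators n r) = ?A" "distinct (ordered_generators n r)"
    by auto
qed

section \<open>Monomials as words, and straightening modulo lower weight\<close>

definition monomial_word :: "(nat \<times> nat) list \<Rightarrow> (nat \<times> nat \<Rightarrow> nat) \<Rightarrow> (nat \<times> nat) list" where
  "monomial_word gs e = concat (map (\<lambda>g. replicate (e g) g) gs)"

lemma set_monomial_word: "set (monomial_word gs e) \<subseteq> set gs"
  by (auto simp: monomial_word_def)

lemma count_monomial_word:
  "distinct gs \<Longrightarrow> count (mset (monomial_word gs e)) g = (if g \<in> set gs then e g else 0)"
  by (induction gs) (auto simp: monomial_word_def)

lemma gen_coset: "gen n p g = coset n p (word [g])"
  by (simp add: gen_def coset_def free_gen_word)

lemma coset_word_mult:
  "set u \<subseteq> generators n \<Longrightarrow> set v \<subseteq> generators n \<Longrightarrow>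
    coset n p (word u) \<otimes>\<^bsub>Fq_int n p\<^esub> coset n p (word v) = coset n p (word (u @ v))"
  by (simp add: coset_mult word_closed word_mult)

lemma gen_pow:
  assumes "g \<in> generators n"
  shows "gen n p g [^]\<^bsub>Fq_int n p\<^esub> (k :: nat) = coset n p (word (replicate k g))"
proof (induction k)
  case 0
  show ?case
    by (simp add: nat_pow_def Fq_int_one word_Nil)
next
  case (Suc k)
  have "set (replicate k g) \<subseteq> generators n"
    using assms by auto
  with Suc show ?case
    using assms by (simp only: nat_pow_def gen_coset nat.rec coset_word_mult list.set empty_subsetI
      insert_subset simp_thms replicate_append_same replicate_Suc)
qed

lemma foldr_gen_pow:
  assumes "set gs \<subseteq> generators n"
  shows "foldr (\<lambda>g m. gen n p g [^]\<^bsub>Fq_int n p\<^esub> e g \<otimes>\<^bsub>Fq_int n p\<^esub> m) gs \<one>\<^bsub>Fq_int n p\<^esub>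
    = (coset n p (word (monomial_word gs e)) :: 'k::field free_alg set)"
  using assms
proof (induction gs)
  case Nil
  then show ?case
    by (simp add: monomial_word_def Fq_int_one word_Nil)
next
  case (Cons g gs)
  have "coset n p (word (replicate (e g) g)) \<otimes>\<^bsub>Fq_int n p\<^esub> coset n p (word (monomial_word gs e))
      = (coset n p (word (replicate (e g) g @ monomial_word gs e)) :: 'k free_alg set)"
    by (rule coset_word_mult) (use Cons.prems set_monomial_word[of gs e] in auto)
  then show ?case
    using Cons by (simp add: gen_pow) (simp add: monomial_word_def)
qed

lemma monomial_eq:
  assumes "linear_order_on (generators n) r"
  shows "monomial n p r e = coset n p (word (monomial_word (ordered_generators n r) e))"
  unfolding monomial_def by (rule foldr_gen_pow) (simp add: ordered_generators[OF assms])

text \<open>The defining relations express a product in one order of its two factors only.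
  Multiplication by \<open>- c'\<close> solves for the other order.\<close>

lemma swap_flip:
  fixes c c' d :: "'k::field laurent"
  assumes "word [b, a] - (scalar c * word [a, b] + scalar d * word z) \<in> rel_ideal n p" "c' * c = 1"
  shows "word [a, b] - (scalar c' * word [b, a] + scalar (- c' * d) * word z) \<in> rel_ideal n p"
proof -
  let ?x = "word [b, a] - (scalar c * word [a, b] + scalar d * word z)"
  have "scalar (- c') * ?x \<in> rel_ideal n p"
    using assms(1) by (rule rel_ideal_mult) (rule scalar_closed)
  moreover have "scalar (- c') * ?x = word [a, b] - (scalar c' * word [b, a] + scalar (- c' * d) * word z)"
    using assms(2) by (simp add: scalar_uminus algebra_simps flip: scalar_mult mult.assoc) (simp add: scalar_1)
  ultimately show ?thesis
    by simp
qed

lemma qs_mult_inv: "bit_sign x * qs_inv p i * (bit_sign x * qs p i) = (1 :: 'k::field laurent)"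
proof -
  have "qs_inv p i * qs p i = (1 :: 'k laurent)"
    by (simp add: qs_def qs_inv_def mult_single)
  then show ?thesis
    by (cases x) (simp_all add: bit_sign_def)
qed

text \<open>The two orders of a pair have equal weight, so the correction term is lighter whichever
  order is wanted; this is why no compatibility with the order of generators is required. Relations
  without exchange term take \<open>d = 0\<close> and the empty word.\<close>

lemma swap_relation:
  assumes a: "a \<in> generators n" and b: "b \<in> generators n" and "a \<noteq> b"
  shows "\<exists>c d z. set z \<subseteq> generators n \<and> (d = 0 \<or> weight z < weight [a, b])
    \<and> word [a, b] - (scalar c * word [b, a] + scalar d * word z) \<in> (rel_ideal n p :: 'k::field free_alg set)"
proof -
  let ?I = "rel_ideal n p :: 'k free_alg set"
  obtain i j h k where ab: "a = (i, j)" "b = (h, k)"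
    by (cases a; cases b)
  have in_range: "i \<in> {1..n}" "j \<in> {1..n}" "h \<in> {1..n}" "k \<in> {1..n}"
    using a b by (auto simp: ab generators_def)
  note rel = subsetD[OF relations_rel_ideal]
  have row: "word [(i, j), (i, k)] - (scalar (bit_sign (par p i j * par p i k) * qs p i) * word [(i, k), (i, j)] + scalar 0 * word []) \<in> ?I"
    if "i \<in> {1..n}" "j \<in> {1..n}" "k \<in> {1..n}" "j < k" for i j k
    by (rule rel, unfold relations_def free_gen_word word_mult append.simps scalar_0 mult_zero_left add_0_right) (use that in blast)
  have col: "word [(i, j), (h, j)] - (scalar (bit_sign (par p i j * par p h j) * qs p j) * word [(h, j), (i, j)] + scalar 0 * word []) \<in> ?I"
    if "i \<in> {1..n}" "j \<in> {1..n}" "h \<in> {1..n}" "i < h" for i j h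
    by (rule rel, unfold relations_def free_gen_word word_mult append.simps scalar_0 mult_zero_left add_0_right) (use that in blast)
  have comm: "word [(i, j), (h, k)] - (scalar (bit_sign (par p i j * par p h k)) * word [(h, k), (i, j)] + scalar 0 * word []) \<in> ?I"
    if "i \<in> {1..n}" "j \<in> {1..n}" "h \<in> {1..n}" "k \<in> {1..n}" "i < h" "j > k" for i j h k
    by (rule rel, unfold relations_def free_gen_word word_mult append.simps scalar_0 mult_zero_left add_0_right) (use that in blast)
  have cross: "word [(i, j), (h, k)] - (scalar (bit_sign (par p i j * par p h k)) * word [(h, k), (i, j)]
      + scalar (bit_sign (par p i j * par p i k) * (qs p i - qs_inv p i)) * word [(i, k), (h, j)]) \<in> ?I"
    if "i \<in> {1..n}" "j \<in> {1..n}" "h \<in> {1..n}" "k \<in> {1..n}" "i < h" "j < k" for i j h k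
    by (rule rel, unfold relations_def free_gen_word word_mult append.simps) (use that in blast)
  have direct: ?thesis
    if "word [a, b] - (scalar c * word [b, a] + scalar d * word z) \<in> ?I" "set z \<subseteq> generators n"
      "d = 0 \<or> weight z < weight [a, b]" for c d z
    using that by blast
  have flip: ?thesis
    if "word [b, a] - (scalar c * word [a, b] + scalar d * word z) \<in> ?I" "c' * c = 1" "set z \<subseteq> generators n"
      "d = 0 \<or> weight z < weight [a, b]" for c c' d z
    by (rule direct[OF swap_flip[OF that(1,2)] that(3)]) (use that(4) in auto)
  consider "i = h" "j < k" | "i = h" "k < j" | "j = k" "i < h" | "j = k" "h < i" | "i < h" "k < j" | "h < i" "j < k"
    | "i < h" "j < k" | "h < i" "k < j"
    using \<open>a \<noteq> b\<close> unfolding ab by (cases i h rule: linorder_cases; cases j k rule: linorder_cases) auto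
  then show ?thesis
  proof cases
    case 1
    show ?thesis
      unfolding ab 1(1) by (rule direct[unfolded ab 1(1), OF row]) (use in_range 1 in auto)
  next
    case 2
    show ?thesis
      unfolding ab 2(1) by (rule flip[unfolded ab 2(1), OF row qs_mult_inv]) (use in_range 2 in auto)
  next
    case 3
    show ?thesis
      unfolding ab 3(1) by (rule direct[unfolded ab 3(1), OF col]) (use in_range 3 in auto)
  next
    case 4
    show ?thesis
      unfolding ab 4(1) by (rule flip[unfolded ab 4(1), OF col qs_mult_inv]) (use in_range 4 in auto)
  next
    case 5
    show ?thesis
      unfolding ab by (rule direct[unfolded ab, OF comm]) (use in_range 5 in auto)
  next
    case 6
    show ?thesis
      unfolding ab by (rule flip[unfolded ab, OF comm bit_sign_square(1)]) (use in_range 6 in auto)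
  next
    case 7
    show ?thesis
      unfolding ab by (rule direct[unfolded ab, OF cross])
        (use in_range 7 weight_exchange[of i h j k "[]" "[]"] in \<open>auto simp: generators_def add.commute\<close>)
  next
    case 8
    show ?thesis
      unfolding ab by (rule flip[unfolded ab, OF cross bit_sign_square(1)])
        (use in_range 8 weight_exchange[of h i k j "[]" "[]"] in \<open>auto simp: generators_def add.commute\<close>)
  qed
qed

lemma sorted_adjacent:
  fixes f :: "'a \<Rightarrow> 'b::linorder"
  assumes "\<And>u a b v. w = u @ a # b # v \<Longrightarrow> f a \<le> f b"
  shows "sorted (map f w)"
  using assms
proof (induction w)
  case (Cons x w)
  have "sorted (map f w)"
    by (rule Cons.IH) (use Cons.prems in \<open>metis append_Cons\<close>)
  moreover have "f x \<le> f y" if "w = y # v" for y v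
    using Cons.prems[of "[]" x y v] that by simp
  ultimately show ?case
    by (cases w) auto
qed simp

lemma sorted_monomial_word: "sorted (map f gs) \<Longrightarrow> sorted (map f (monomial_word gs e))"
proof (induction gs)
  case (Cons g gs)
  then show ?case
    using set_monomial_word[of gs e] by (auto simp: monomial_word_def sorted_append)
qed (simp add: monomial_word_def)

text \<open>A word sorted by an injective key is determined by its multiset of letters, and the
  monomial built from its own counts has that multiset.\<close>

lemma monomial_word_unique:
  assumes "distinct gs" "sorted (map f gs)" "inj_on f (set gs)" "set w \<subseteq> set gs" "sorted (map f w)"
  shows "w = monomial_word gs (count (mset w))"
proof -
  let ?m = "monomial_word gs (count (mset w))"
  have mset: "mset ?m = mset w"
    by (rule multiset_eqI) (use assms(1,4) in \<open>auto simp: count_monomial_word count_eq_zero_iff\<close>)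
  have "mset (map f w) = mset (map f ?m)"
    using mset by simp
  then have "map f w = map f ?m"
    using properties_for_sort assms(5) sorted_monomial_word[OF assms(2)] by metis
  then show ?thesis
    by (rule map_inj_on) (use assms(3,4) set_monomial_word[of gs] in \<open>auto intro: inj_on_subset\<close>)
qed

lemma monomial_word_repeat:
  assumes "a \<in> set gs" "2 \<le> e a"
  shows "\<exists>u v. monomial_word gs e = u @ a # a # v"
proof -
  obtain g1 g2 where "gs = g1 @ a # g2"
    using assms(1) by (meson split_list)
  moreover obtain k where "e a = Suc (Suc k)"
    using assms(2) by (metis Suc_le_D numeral_2_eq_2 Suc_le_mono)
  ultimately have "monomial_word gs e = monomial_word g1 e @ a # a # (replicate k a @ monomial_word g2 e)"
    by (simp add: monomial_word_def)
  then show ?thesis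
    by blast
qed

lemma position_exists:
  assumes "distinct gs"
  shows "\<exists>f :: 'a \<Rightarrow> nat. sorted (map f gs) \<and> inj_on f (set gs)"
proof -
  let ?f = "the_inv_into {..<length gs} (nth gs)"
  have inj: "inj_on (nth gs) {..<length gs}"
    using assms by (simp add: inj_on_nth)
  have "map ?f gs = [0..<length gs]"
    by (rule nth_equalityI) (simp_all add: the_inv_into_f_f[OF inj])
  then have "sorted (map ?f gs)" "distinct (map ?f gs)"
    by simp_all
  then show ?thesis
    by (auto simp: distinct_map)
qed

text \<open>Induction on weight first and inversions second: a swap keeps the weight and lowers the
  inversions, while the correction term may be badly ordered but is lighter. Sorted words are
  monomials, and those with a forbidden repetition are zero in the quotient.\<close>

lemma coset_word_in_span:
  fixes gs :: "(nat \<times> nat) list" and n p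
  defines "B \<equiv> (\<lambda>e. coset n p (word (monomial_word gs e))) ` exponents n p :: 'k::field free_alg set set"
  assumes gs: "set gs = generators n" "distinct gs"
  shows "set w \<subseteq> generators n \<Longrightarrow> coset n p (word w) \<in> LinearCombinations.module.span class_ring (Fq_int n p) B"
proof -
  interpret M: Module.module "class_ring :: 'k laurent ring" "Fq_int n p"
    by (rule module_Fq_int)
  have closed: "word w \<in> carrier (free_algebra n)" if "set w \<subseteq> generators n" for w
    using that by (rule word_closed)
  have B: "B \<subseteq> carrier (Fq_int n p)"
    using set_monomial_word[of gs] gs by (auto simp: B_def carrier_Fq_int intro!: imageI closed)
  interpret S: submodule "class_ring :: 'k laurent ring" "M.span B" "Fq_int n p"
    by (rule M.span_is_submodule[OF B])
  obtain f :: "nat \<times> nat \<Rightarrow> nat" where f: "sorted (map f gs)" "inj_on f (set gs)"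
    using position_exists[OF gs(2)] by blast
  let ?R = "\<lambda>x y. f y < f x"
  show "set w \<subseteq> generators n \<Longrightarrow> coset n p (word w) \<in> M.span B"
  proof (induction w rule: wf_induct_rule[OF wf_measures[of "[weight, inversions ?R]"]])
    case (1 w)
    show ?case
    proof (cases "\<exists>u a b v. w = u @ a # b # v \<and> f b < f a")
      case True
      then obtain u a b v where w: "w = u @ a # b # v" and ab: "f b < f a"
        by blast
      have in_gen: "set u \<subseteq> generators n" "set v \<subseteq> generators n" "a \<in> generators n" "b \<in> generators n"
        using 1(2) by (auto simp: w)
      obtain c d z where z: "set z \<subseteq> generators n" "d = 0 \<or> weight z < weight [a, b]"
        and rel: "word [a, b] - (scalar c * word [b, a] + scalar d * word z) \<in> (rel_ideal n p :: 'k free_alg set)"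
        using swap_relation[OF in_gen(3,4), of p] ab by blast
      let ?w1 = "u @ b # a # v" and ?w2 = "u @ z @ v"
      have sub: "set ?w1 \<subseteq> generators n" "set ?w2 \<subseteq> generators n"
        using in_gen z by auto
      have "word u * (word [a, b] - (scalar c * word [b, a] + scalar d * word z)) * word v \<in> (rel_ideal n p :: 'k free_alg set)"
        by (intro rel_ideal_mult rel closed in_gen)
      also have "word u * (word [a, b] - (scalar c * word [b, a] + scalar d * word z)) * word v
          = word w - (scalar c * word ?w1 + scalar d * (word ?w2 :: 'k free_alg))"
        by (simp only: right_diff_distrib left_diff_distrib distrib_left distrib_right scalar_left_commute
            mult.assoc word_mult append.simps append_assoc w)
      finally have "coset n p (word w) = coset n p (scalar c * word ?w1 + scalar d * (word ?w2 :: 'k free_alg))"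
        using 1(2) sub
        by (subst coset_eq_iff) (simp_all add: closed free_algebra_add_closed free_algebra_mult_closed scalar_closed)
      also have "\<dots> = c \<odot>\<^bsub>Fq_int n p\<^esub> coset n p (word ?w1) \<oplus>\<^bsub>Fq_int n p\<^esub> coset n p (scalar d * word ?w2)"
        using sub by (simp add: coset_add coset_smult closed free_algebra_mult_closed scalar_closed)
      finally have eq: "coset n p (word w) = \<dots>" .
      have "inversions ?R (u @ [b, a] @ v) + inversions ?R [a, b] = inversions ?R (u @ [a, b] @ v) + inversions ?R [b, a]"
        by (rule inversions_context) auto
      then have "(?w1, w) \<in> measures [weight, inversions ?R]"
        using ab weight_mset[of ?w1 w] by (simp add: w)
      then have "coset n p (word ?w1) \<in> M.span B"
        using 1(1) sub by blast
      moreover have "coset n p (scalar d * word ?w2) \<in> M.span B"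
      proof (cases "d = 0")
        case True
        then show ?thesis
          using S.zero_closed by (simp add: scalar_0 Fq_int_zero)
      next
        case False
        then have "(?w2, w) \<in> measures [weight, inversions ?R]"
          using z by (simp add: w)
        then have "coset n p (word ?w2) \<in> M.span B"
          using 1(1) sub by blast
        then have "d \<odot>\<^bsub>Fq_int n p\<^esub> coset n p (word ?w2) \<in> M.span B"
          by (intro S.smult_closed) simp_all
        then show ?thesis
          using sub by (simp add: coset_smult closed)
      qed
      ultimately show ?thesis
        unfolding eq by (intro S.m_closed S.smult_closed) simp_all
    next
      case False
      then have "sorted (map f w)"
        by (intro sorted_adjacent) (use not_le in blast)
      then have w: "w = monomial_word gs (count (mset w))"
        using monomial_word_unique[OF gs(2) f] 1(2) gs(1) by simp
      \<comment> \<open>Exponents are functions that are undefined outside the generators, so the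
        counting function has to be restricted before it belongs to
        \<open>exponents\<close>.\<close>
      let ?e = "restrict (count (mset w)) (generators n)"
      have w': "w = monomial_word gs ?e"
        by (subst w) (auto simp: monomial_word_def gs(1)[symmetric] intro!: arg_cong[of _ _ concat])
      show ?thesis
      proof (cases "\<exists>i j. (i, j) \<in> generators n \<and> par p i j = 1 \<and> 2 \<le> count (mset w) (i, j)")
        case True
        then obtain i j where ij: "(i, j) \<in> generators n" "par p i j = 1" "2 \<le> count (mset w) (i, j)"
          by blast
        then obtain u v where uv: "w = u @ (i, j) # (i, j) # v"
          using monomial_word_repeat[of "(i, j)" gs "count (mset w)"] w gs(1) by auto
        have "free_gen i j ^ 2 \<in> (rel_ideal n p :: 'k free_alg set)"
          by (rule subsetD[OF relations_rel_ideal], unfold relations_def)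
            (use ij in \<open>auto simp: generators_def\<close>)
        then have "word u * free_gen i j ^ 2 * word v \<in> (rel_ideal n p :: 'k free_alg set)"
          using 1(2) by (intro rel_ideal_mult closed) (auto simp: uv)
        then have "word w - 0 \<in> (rel_ideal n p :: 'k free_alg set)"
          by (simp add: uv power2_eq_square free_gen_word word_mult)
        then have "coset n p (word w) = coset n p (0 :: 'k free_alg)"
          using 1(2) by (subst coset_eq_iff) (simp_all add: closed free_algebra_zero_closed)
        then show ?thesis
          using S.zero_closed by (simp add: Fq_int_zero)
      next
        case False
        then have "?e \<in> exponents n p"
          by (fastforce simp: exponents_def not_le numeral_2_eq_2 less_Suc_eq_le)
        then have "coset n p (word w) \<in> B"
          unfolding B_def by (rule rev_image_eqI) (rule arg_cong[OF w', of "\<lambda>w. coset n p (word w)"])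
        then show ?thesis
          using M.in_own_span[OF B] by blast
      qed
    qed
  qed
qed

lemma span_monomials:
  fixes gs :: "(nat \<times> nat) list" and n p
  defines "B \<equiv> (\<lambda>e. coset n p (word (monomial_word gs e))) ` exponents n p :: 'k::field free_alg set set"
  assumes gs: "set gs = generators n" "distinct gs"
  shows "B \<subseteq> carrier (Fq_int n p)"
    and "LinearCombinations.module.span class_ring (Fq_int n p) B = carrier (Fq_int n p)"
proof -
  interpret M: Module.module "class_ring :: 'k laurent ring" "Fq_int n p"
    by (rule module_Fq_int)
  show B: "B \<subseteq> carrier (Fq_int n p)"
    using set_monomial_word[of gs] gs by (auto simp: B_def carrier_Fq_int intro!: imageI word_closed)
  interpret S: submodule "class_ring :: 'k laurent ring" "M.span B" "Fq_int n p"
    by (rule M.span_is_submodule[OF B])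
  have "f \<in> carrier (free_algebra n) \<and> coset n p f \<in> M.span B" if "f \<in> carrier (free_algebra n)" for f
  proof (rule poly_mapping_induct_single[where S = "{w. set (letters w) \<subseteq> generators n}" and f = f])
    show "Poly_Mapping.single w c \<in> carrier (free_algebra n) \<and> coset n p (Poly_Mapping.single w c) \<in> M.span B"
      if "w \<in> {w. set (letters w) \<subseteq> generators n}" for w c
    proof -
      have w: "set (letters w) \<subseteq> generators n"
        using that by simp
      have "coset n p (word (letters w)) \<in> M.span B"
        unfolding B_def by (rule coset_word_in_span[OF gs w])
      then have "c \<odot>\<^bsub>Fq_int n p\<^esub> coset n p (word (letters w)) \<in> M.span B"
        by (intro S.smult_closed) simp_all
      moreover have "Poly_Mapping.single w c = scalar c * word (letters w)"
        by (simp add: scalar_word)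
      ultimately show ?thesis
        using w by (simp add: coset_smult word_closed free_algebra_mult_closed scalar_closed)
    qed
  next
    show "0 \<in> carrier (free_algebra n) \<and> coset n p 0 \<in> M.span B"
      using S.zero_closed by (simp add: Fq_int_zero free_algebra_zero_closed)
  next
    fix f g :: "'k free_alg"
    assume "f \<in> carrier (free_algebra n) \<and> coset n p f \<in> M.span B" "g \<in> carrier (free_algebra n) \<and> coset n p g \<in> M.span B"
    then show "f + g \<in> carrier (free_algebra n) \<and> coset n p (f + g) \<in> M.span B"
      using S.m_closed[of "coset n p f" "coset n p g"] by (simp add: free_algebra_add_closed coset_add)
  next
    show "Poly_Mapping.keys f \<subseteq> {w. set (letters w) \<subseteq> generators n}"
      using that by (auto simp: carrier_free_algebra)
  qed
  then show "M.span B = carrier (Fq_int n p)"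
    using S.subset by (auto simp: carrier_Fq_int)
qed

section \<open>Coordinates on the quotient\<close>

definition coord :: "nat \<Rightarrow> (nat \<Rightarrow> bit) \<Rightarrow> (nat \<times> nat) list \<Rightarrow> 'k::field free_alg set \<Rightarrow> 'k laurent" where
  "coord n p t C = linear_ext (twisted_coeff p t) (SOME f. f \<in> carrier (free_algebra n) \<and> coset n p f = C)"

text \<open>Two representatives differ by an element of the ideal, which the twisted coefficients
  kill.\<close>

lemma coord_coset:
  assumes f: "f \<in> carrier (free_algebra n)"
  shows "coord n p t (coset n p f) = linear_ext (twisted_coeff p t) f"
proof -
  let ?g = "SOME g. g \<in> carrier (free_algebra n) \<and> coset n p g = coset n p f"
  have g: "?g \<in> carrier (free_algebra n) \<and> coset n p ?g = coset n p f"
    by (rule someI[of _ f]) (simp add: f)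
  then have "?g - f \<in> rel_ideal n p"
    using coset_eq_iff[of ?g n f p] f by simp
  then have "linear_ext (twisted_coeff p t) (?g - f) = 0"
    by (rule linear_ext_rel_ideal[rotated]) (rule twisted_coeff_relations)
  then show ?thesis
    by (simp add: coord_def linear_ext_diff)
qed

lemma coord_add:
  "x \<in> carrier (Fq_int n p) \<Longrightarrow> y \<in> carrier (Fq_int n p) \<Longrightarrow>
    coord n p t (x \<oplus>\<^bsub>Fq_int n p\<^esub> y) = coord n p t x + coord n p t y"
  by (auto simp: carrier_Fq_int coset_add coord_coset free_algebra_add_closed linear_ext_add)

lemma coord_smult:
  "x \<in> carrier (Fq_int n p) \<Longrightarrow> coord n p t (c \<odot>\<^bsub>Fq_int n p\<^esub> x) = c * coord n p t x"
  by (auto simp: carrier_Fq_int coset_smult coord_coset free_algebra_mult_closed scalar_closed linear_ext_scalar)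

text \<open>The functional attached to \<open>e\<close> is the coefficient of the normal
  rearrangement of its monomial, which exists because \<open>e\<close> is truncated. Distinct
  exponents give distinct multisets, so off the diagonal \<open>normal_coeff_triangular\<close>
  yields zero; the twist contributes only signs.\<close>

lemma coord_triangular:
  fixes gs :: "(nat \<times> nat) list" and n p
  assumes gs: "set gs = generators n" "distinct gs"
  shows "\<exists>t. (\<forall>e\<in>exponents n p. coord n p (t e) (coset n p (word (monomial_word gs e)) :: 'k::field free_alg set) dvd 1)
    \<and> (\<forall>e\<in>exponents n p. \<forall>e'\<in>exponents n p. e \<noteq> e' \<longrightarrow> weight (monomial_word gs e') \<le> weight (monomial_word gs e)
        \<longrightarrow> coord n p (t e) (coset n p (word (monomial_word gs e')) :: 'k free_alg set) = 0)"
proof -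
  interpret quantum_parameters "Poly_Mapping.single 1 1 :: 'k laurent" "Poly_Mapping.single (- 1) 1" "\<lambda>i. p i = 1"
    by (rule quantum_parameters_laurent)
  have "\<exists>t. normal_word t \<and> mset t = mset (monomial_word gs e)" if e: "e \<in> exponents n p" for e
  proof (rule normal_word_exists)
    fix a :: "nat \<times> nat"
    assume "(p (fst a) = 1) \<noteq> (p (snd a) = 1)"
    then have "par p (fst a) (snd a) = 1"
      by (cases "p (fst a)"; cases "p (snd a)") (simp_all add: par_def)
    then have "a \<in> generators n \<Longrightarrow> e a \<le> 1"
      using e unfolding exponents_def by (cases a) fastforce
    then show "count (mset (monomial_word gs e)) a \<le> 1"
      using gs by (simp add: count_monomial_word)
  qed
  then obtain t where t: "\<And>e. e \<in> exponents n p \<Longrightarrow> normal_word (t e) \<and> mset (t e) = mset (monomial_word gs e)"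
    by metis
  have coord: "coord n p (t e) (coset n p (word (monomial_word gs e')) :: 'k free_alg set)
      = bit_sign (twist p (monomial_word gs e')) * normal_coeff (t e) (monomial_word gs e')" for e e'
    using set_monomial_word[of gs e'] gs(1)
    by (simp add: coord_coset word_closed linear_ext_word twisted_coeff_def)
  have unit: "bit_sign b * x dvd 1" if "x dvd 1" for x :: "'k laurent" and b
    using that by (cases b) (simp_all add: bit_sign_def)
  have neq: "mset (t e) \<noteq> mset (monomial_word gs e')"
    if "e \<in> exponents n p" "e' \<in> exponents n p" "e \<noteq> e'" for e e'
  proof
    assume "mset (t e) = mset (monomial_word gs e')"
    then have "mset (monomial_word gs e) = mset (monomial_word gs e')"
      using t that by simp
    then have "e g = e' g" if "g \<in> generators n" for g
      using that gs count_monomial_word[OF gs(2)] by metis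
    then have "e = e'"
      using that by (intro PiE_ext[of e "generators n" "\<lambda>_. UNIV"]) (simp_all add: exponents_def)
    then show False
      using that by simp
  qed
  have weight: "weight (t e) = weight (monomial_word gs e)" if "e \<in> exponents n p" for e
    using t[OF that] weight_mset by blast
  show ?thesis
  proof (intro exI[of _ t] conjI ballI impI)
    fix e assume "e \<in> exponents n p"
    then show "coord n p (t e) (coset n p (word (monomial_word gs e)) :: 'k free_alg set) dvd 1"
      unfolding coord using t by (intro unit normal_coeff_triangular(2)) auto
  next
    fix e e' assume "e \<in> exponents n p" "e' \<in> exponents n p" "e \<noteq> e'"
      and "weight (monomial_word gs e') \<le> weight (monomial_word gs e)"
    then have "normal_coeff (t e) (monomial_word gs e') = 0"
      using t neq weight by (intro normal_coeff_triangular(1)) auto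
    then show "coord n p (t e) (coset n p (word (monomial_word gs e')) :: 'k free_alg set) = 0"
      unfolding coord by simp
  qed
qed

section \<open>Extension of scalars\<close>

locale scalar_extension =
  fixes \<phi> :: "'c::comm_ring_1 \<Rightarrow> 'd::comm_ring_1" and M :: "('c, 'm) module"
  assumes \<phi>_add: "\<phi> (x + y) = \<phi> x + \<phi> y" and \<phi>_mult: "\<phi> (x * y) = \<phi> x * \<phi> y" and \<phi>_one: "\<phi> 1 = 1"
    and module_M: "Module.module class_ring M"
begin

sublocale M: Module.module "class_ring :: 'c ring" M
  by (rule module_M)

definition pairs :: "('d \<times> 'm \<Rightarrow>\<^sub>0 int) monoid" where
  "pairs = free_Abelian_group (carrier (class_ring :: 'd ring) \<times> carrier M)"

definition kernel :: "('d \<times> 'm \<Rightarrow>\<^sub>0 int) set" where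
  "kernel = tensor_kernel (class_ring :: 'd ring) \<phi> (class_ring :: 'c ring) M"

definition tensor :: "('d \<times> 'm \<Rightarrow>\<^sub>0 int) \<Rightarrow> ('d \<times> 'm \<Rightarrow>\<^sub>0 int) set" where
  "tensor s = kernel #>\<^bsub>pairs\<^esub> s"

definition extension :: "('d, ('d \<times> 'm \<Rightarrow>\<^sub>0 int) set) module" where
  "extension = base_change (class_ring :: 'd ring) \<phi> (class_ring :: 'c ring) M"

definition scale :: "'d \<Rightarrow> ('d \<times> 'm \<Rightarrow>\<^sub>0 int) \<Rightarrow> ('d \<times> 'm \<Rightarrow>\<^sub>0 int)" where
  "scale c = frag_extend (\<lambda>(a, m). frag_of (c * a, m))"

lemma carrier_pairs: "s \<in> carrier pairs \<longleftrightarrow> Poly_Mapping.keys s \<subseteq> UNIV \<times> carrier M"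
  by (simp add: pairs_def)

lemma pairs_simps [simp]: "x \<otimes>\<^bsub>pairs\<^esub> y = x + y" "\<one>\<^bsub>pairs\<^esub> = 0"
  by (simp_all add: pairs_def)

sublocale pairs: comm_group pairs
  unfolding pairs_def by (rule abelian_free_Abelian_group)

lemma inv_pairs: "s \<in> carrier pairs \<Longrightarrow> inv\<^bsub>pairs\<^esub> s = - s"
  unfolding pairs_def by simp

lemma pairs_closed:
  "x \<in> carrier pairs \<Longrightarrow> y \<in> carrier pairs \<Longrightarrow> x + y \<in> carrier pairs"
  "x \<in> carrier pairs \<Longrightarrow> - x \<in> carrier pairs"
  "x \<in> carrier pairs \<Longrightarrow> y \<in> carrier pairs \<Longrightarrow> x - y \<in> carrier pairs"
  "0 \<in> carrier pairs"
  "m \<in> carrier M \<Longrightarrow> frag_of (a, m) \<in> carrier pairs"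
  using pairs.m_closed[of x y] keys_diff[of x y] by (auto simp: carrier_pairs)

lemma pairs_induct [consumes 1, case_names zero diff frag_of]:
  assumes "s \<in> carrier pairs" "P 0"
    "\<And>x y. x \<in> carrier pairs \<Longrightarrow> y \<in> carrier pairs \<Longrightarrow> P x \<Longrightarrow> P y \<Longrightarrow> P (x - y)"
    "\<And>a m. m \<in> carrier M \<Longrightarrow> P (frag_of (a, m))"
  shows "P s"
  by (rule free_Abelian_group_induct[of s "UNIV \<times> carrier M" P]) (use assms in \<open>auto simp: carrier_pairs\<close>)

lemma kernel_eq: "kernel = generate pairs (tensor_relations (class_ring :: 'd ring) \<phi> (class_ring :: 'c ring) M)"
  by (simp add: kernel_def pairs_def tensor_kernel_def)

lemma tensor_relations_closed:
  "tensor_relations (class_ring :: 'd ring) \<phi> (class_ring :: 'c ring) M \<subseteq> carrier pairs"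
  unfolding tensor_relations_def by (auto intro!: pairs_closed M.smult_closed M.M.a_closed)

lemma subgroup_kernel: "subgroup kernel pairs"
  unfolding kernel_eq by (rule pairs.generate_is_subgroup[OF tensor_relations_closed])

lemma kernel_closed: "s \<in> kernel \<Longrightarrow> s \<in> carrier pairs"
  using subgroup.mem_carrier[OF subgroup_kernel] .

lemma kernel_add: "x \<in> kernel \<Longrightarrow> y \<in> kernel \<Longrightarrow> x + y \<in> kernel"
  using subgroup.m_closed[OF subgroup_kernel, of x y] by simp

lemma kernel_diff: "x \<in> kernel \<Longrightarrow> y \<in> kernel \<Longrightarrow> x - y \<in> kernel"
  using kernel_add[of x "- y"] subgroup.m_inv_closed[OF subgroup_kernel, of y] by (simp add: inv_pairs kernel_closed)

lemma kernel_zero: "0 \<in> kernel"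
  using subgroup.one_closed[OF subgroup_kernel] by simp

lemma kernel_relations:
  "m \<in> carrier M \<Longrightarrow> frag_of (a + b, m) - frag_of (a, m) - frag_of (b, m) \<in> kernel"
  "m \<in> carrier M \<Longrightarrow> m' \<in> carrier M \<Longrightarrow> frag_of (a, m \<oplus>\<^bsub>M\<^esub> m') - frag_of (a, m) - frag_of (a, m') \<in> kernel"
  "m \<in> carrier M \<Longrightarrow> frag_of (a * \<phi> c, m) - frag_of (a, c \<odot>\<^bsub>M\<^esub> m) \<in> kernel"
  unfolding kernel_eq by (rule generate.incl, force simp: tensor_relations_def)+

lemma scale_simps:
  "scale c (x - y) = scale c x - scale c y" "scale c 0 = 0" "scale c (frag_of (a, m)) = frag_of (c * a, m)"
  by (simp_all add: scale_def frag_extend_diff)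

lemma scale_closed: "s \<in> carrier pairs \<Longrightarrow> scale c s \<in> carrier pairs"
  by (induction s rule: pairs_induct) (simp_all add: scale_simps pairs_closed)

lemma kernel_minimal:
  assumes "subgroup H pairs" "tensor_relations (class_ring :: 'd ring) \<phi> (class_ring :: 'c ring) M \<subseteq> H"
  shows "kernel \<subseteq> H"
  unfolding kernel_eq by (rule pairs.generate_subgroup_incl[OF assms(2,1)])

lemma subgroup_pairsI:
  assumes "H \<subseteq> carrier pairs" "0 \<in> H" "\<And>x y. x \<in> H \<Longrightarrow> y \<in> H \<Longrightarrow> x - y \<in> H"
  shows "subgroup H pairs"
proof (rule pairs.subgroupI)
  have neg: "- x \<in> H" if "x \<in> H" for x
    using assms(3)[OF assms(2) that] by simp
  show "inv\<^bsub>pairs\<^esub> x \<in> H" if "x \<in> H" for x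
    using neg[OF that] that assms(1) by (simp add: inv_pairs subset_iff)
  show "x \<otimes>\<^bsub>pairs\<^esub> y \<in> H" if "x \<in> H" "y \<in> H" for x y
    using assms(3)[OF that(1) neg[OF that(2)]] by simp
qed (use assms in auto)

text \<open>The elements that scaling sends into the kernel form a subgroup, so the generating
  relations suffice. This makes the scalar action on the tensor product well defined.\<close>

lemma scale_kernel:
  assumes "s \<in> kernel"
  shows "scale c s \<in> kernel"
proof -
  let ?H = "{s \<in> carrier pairs. scale c s \<in> kernel}"
  have "subgroup ?H pairs"
    by (rule subgroup_pairsI) (auto simp: pairs_closed scale_simps kernel_zero kernel_diff)
  moreover have "tensor_relations (class_ring :: 'd ring) \<phi> (class_ring :: 'c ring) M \<subseteq> ?H"
  proof
    fix s assume s: "s \<in> tensor_relations (class_ring :: 'd ring) \<phi> (class_ring :: 'c ring) M"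
    then have "scale c s \<in> kernel"
      unfolding tensor_relations_def
      by (auto simp: scale_simps distrib_left kernel_relations simp flip: mult.assoc)
    then show "s \<in> ?H"
      using s tensor_relations_closed by auto
  qed
  ultimately have "kernel \<subseteq> ?H"
    by (rule kernel_minimal)
  then show ?thesis
    using assms by blast
qed

lemma tensor_eq_iff:
  assumes "x \<in> carrier pairs" "y \<in> carrier pairs"
  shows "tensor x = tensor y \<longleftrightarrow> x - y \<in> kernel"
proof
  assume "tensor x = tensor y"
  then have "x \<in> kernel #>\<^bsub>pairs\<^esub> y"
    using pairs.rcos_self[OF assms(1) subgroup_kernel] by (simp add: tensor_def)
  then show "x - y \<in> kernel"
    by (auto simp: r_coset_def)
next
  assume "x - y \<in> kernel"
  then have "x \<in> kernel #>\<^bsub>pairs\<^esub> y"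
    by (force simp: r_coset_def)
  then show "tensor x = tensor y"
    unfolding tensor_def using pairs.repr_independence[OF _ assms(2) subgroup_kernel] by simp
qed

lemma carrier_extension: "carrier extension = tensor ` carrier pairs"
proof -
  have "carrier extension = carrier (pairs Mod kernel)"
    unfolding extension_def base_change_def Let_def pairs_def kernel_def by simp
  then show ?thesis
    by (auto simp: FactGroup_def RCOSETS_def tensor_def)
qed

lemma extension_add:
  assumes "x \<in> carrier pairs" "y \<in> carrier pairs"
  shows "tensor x \<oplus>\<^bsub>extension\<^esub> tensor y = tensor (x + y)"
proof -
  have "tensor x \<oplus>\<^bsub>extension\<^esub> tensor y = tensor x \<otimes>\<^bsub>pairs Mod kernel\<^esub> tensor y"
    unfolding extension_def base_change_def Let_def pairs_def kernel_def by simp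
  moreover have "kernel \<lhd> pairs"
    using subgroup_kernel by (simp add: pairs.normal_iff_subgroup)
  ultimately show ?thesis
    using normal.rcos_sum[of kernel pairs x y] assms by (simp add: FactGroup_def tensor_def)
qed

lemma extension_zero: "\<zero>\<^bsub>extension\<^esub> = tensor 0"
proof -
  have "kernel #>\<^bsub>pairs\<^esub> 0 = kernel"
    using pairs.coset_join2[OF _ subgroup_kernel kernel_zero] pairs_closed by simp
  moreover have "\<zero>\<^bsub>extension\<^esub> = \<one>\<^bsub>pairs Mod kernel\<^esub>"
    unfolding extension_def base_change_def Let_def pairs_def kernel_def by simp
  ultimately show ?thesis
    by (simp add: FactGroup_def tensor_def)
qed

lemma extension_smult:
  assumes x: "x \<in> carrier pairs"
  shows "c \<odot>\<^bsub>extension\<^esub> tensor x = tensor (scale c x)"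
proof -
  have eq: "tensor (scale c y) = tensor (scale c x)" if y: "y \<in> tensor x" for y
  proof -
    obtain k where k: "k \<in> kernel" "y = k + x"
      using y by (auto simp: tensor_def r_coset_def)
    then have "scale c y - scale c x = scale c k"
      using scale_simps(1)[of c y x] by simp
    then show ?thesis
      using k x by (simp add: tensor_eq_iff scale_closed pairs_closed kernel_closed scale_kernel)
  qed
  have "c \<odot>\<^bsub>extension\<^esub> tensor x = (\<Union>y\<in>tensor x. tensor (scale c y))"
    unfolding extension_def base_change_def Let_def tensor_def scale_def pairs_def kernel_def by simp
  also have "\<dots> = (\<Union>y\<in>tensor x. tensor (scale c x))"
    by (intro SUP_cong) (simp_all add: eq)
  also have "\<dots> = tensor (scale c x)"
    using pairs.rcos_self[OF x subgroup_kernel] by (auto simp: tensor_def)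
  finally show ?thesis .
qed

text \<open>In the free abelian group the pair with first entry \<open>a + b\<close> is a generator
  of its own. Distributivity over scalars thus holds only modulo the additivity relations.\<close>

lemma scale_add_kernel: "s \<in> carrier pairs \<Longrightarrow> scale (c + d) s - (scale c s + scale d s) \<in> kernel"
proof (induction s rule: pairs_induct)
  case (diff x y)
  have "scale (c + d) (x - y) - (scale c (x - y) + scale d (x - y))
      = (scale (c + d) x - (scale c x + scale d x)) - (scale (c + d) y - (scale c y + scale d y))"
    by (simp add: scale_simps algebra_simps)
  then show ?case
    using diff kernel_diff by simp
qed (simp_all add: scale_simps kernel_zero distrib_right kernel_relations flip: diff_diff_eq)

lemma scale_mult: "s \<in> carrier pairs \<Longrightarrow> scale (c * d) s = scale c (scale d s)"
  by (induction s rule: pairs_induct) (simp_all add: scale_simps mult.assoc)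

lemma scale_one: "s \<in> carrier pairs \<Longrightarrow> scale 1 s = s"
  by (induction s rule: pairs_induct) (simp_all add: scale_simps)

lemma scale_plus: "scale c (x + y) = scale c x + scale c y"
  by (simp add: scale_def frag_extend_add)

lemma tensor_scale_add: "s \<in> carrier pairs \<Longrightarrow> tensor (scale (c + d) s) = tensor (scale c s + scale d s)"
  by (subst tensor_eq_iff) (simp_all add: scale_closed pairs_closed scale_add_kernel)

lemma module_extension: "Module.module class_ring extension"
proof (rule Module.moduleI)
  show "cring (class_ring :: 'd ring)"
    by (rule class_cring.is_cring)
  show "abelian_group extension"
  proof (rule abelian_groupI)
    fix x assume "x \<in> carrier extension"
    then obtain s where "s \<in> carrier pairs" "x = tensor s"
      by (auto simp: carrier_extension)
    then show "\<exists>y\<in>carrier extension. y \<oplus>\<^bsub>extension\<^esub> x = \<zero>\<^bsub>extension\<^esub>"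
      by (intro bexI[of _ "tensor (- s)"]) (auto simp: carrier_extension extension_add extension_zero pairs_closed)
  qed (auto simp: carrier_extension extension_add extension_zero pairs_closed add_ac)
qed (auto simp: carrier_extension extension_add extension_smult pairs_closed scale_closed scale_mult scale_one
    scale_plus tensor_scale_add)

section \<open>Pure tensors and spanning after base change\<close>

definition pure :: "'m \<Rightarrow> ('d \<times> 'm \<Rightarrow>\<^sub>0 int) set" where
  "pure m = tensor (frag_of (1, m))"

lemma pure_closed: "m \<in> carrier M \<Longrightarrow> pure m \<in> carrier extension"
  by (simp add: pure_def carrier_extension pairs_closed)

lemma pure_add:
  "m \<in> carrier M \<Longrightarrow> m' \<in> carrier M \<Longrightarrow> pure (m \<oplus>\<^bsub>M\<^esub> m') = pure m \<oplus>\<^bsub>extension\<^esub> pure m'"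
  using kernel_relations(2)[of m m' 1]
  by (simp add: pure_def extension_add pairs_closed tensor_eq_iff M.M.a_closed diff_diff_eq)

lemma pure_smult: "m \<in> carrier M \<Longrightarrow> pure (c \<odot>\<^bsub>M\<^esub> m) = \<phi> c \<odot>\<^bsub>extension\<^esub> pure m"
  using kernel_relations(3)[of m 1 c]
  by (simp add: pure_def extension_smult pairs_closed tensor_eq_iff[symmetric] M.smult_closed scale_simps)

lemma pure_zero: "pure \<zero>\<^bsub>M\<^esub> = \<zero>\<^bsub>extension\<^esub>"
proof -
  have "\<phi> 0 = 0"
    using \<phi>_add[of 0 0] by simp
  interpret T: Module.module "class_ring :: 'd ring" extension
    by (rule module_extension)
  show ?thesis
    using pure_smult[of "\<zero>\<^bsub>M\<^esub>" 0] T.smult_l_null[OF pure_closed[OF M.M.zero_closed]]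
      M.smult_l_null[OF M.M.zero_closed] \<open>\<phi> 0 = 0\<close> by simp
qed

text \<open>The elements of \<open>M\<close> whose pure tensors lie in the new span form a submodule
  over the small ring. It contains \<open>B\<close>, hence is everything, and scalar multiples of
  pure tensors generate the extension.\<close>

lemma span_extension:
  assumes B: "B \<subseteq> carrier M" "M.span B = carrier M"
  shows "LinearCombinations.module.span class_ring extension (pure ` B) = carrier extension"
proof -
  interpret T: Module.module "class_ring :: 'd ring" extension
    by (rule module_extension)
  have pB: "pure ` B \<subseteq> carrier extension"
    using B pure_closed by blast
  interpret S: submodule "class_ring :: 'd ring" "T.span (pure ` B)" extension
    by (rule T.span_is_submodule[OF pB])
  let ?N = "{m \<in> carrier M. pure m \<in> T.span (pure ` B)}"
  have "submodule class_ring ?N M"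
  proof (rule submodule.intro)
    fix c :: 'c and m assume "m \<in> ?N"
    then show "c \<odot>\<^bsub>M\<^esub> m \<in> ?N"
      using S.smult_closed[of "\<phi> c" "pure m"] by (simp add: pure_smult M.smult_closed)
  qed (use S.m_closed S.zero_closed in \<open>auto simp: module_M pure_add pure_zero\<close>)
  moreover have "B \<subseteq> ?N"
    using B T.in_own_span[OF pB] by blast
  ultimately have "M.span B \<subseteq> ?N"
    by (intro M.span_is_subset)
  then have pure: "pure m \<in> T.span (pure ` B)" if "m \<in> carrier M" for m
    using B that by blast
  have "tensor s \<in> T.span (pure ` B)" if "s \<in> carrier pairs" for s
    using that
  proof (induction s rule: pairs_induct)
    case zero
    then show ?case
      using S.zero_closed by (simp add: extension_zero)
  next
    case (diff x y)
    \<comment> \<open>A submodule is closed under sums and scalar multiples, so a difference is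
      reached through the scalar -1.\<close>
    have "tensor (- y) \<oplus>\<^bsub>extension\<^esub> tensor y = \<zero>\<^bsub>extension\<^esub>"
      using diff by (simp add: extension_add pairs_closed extension_zero)
    then have "tensor (- y) = \<ominus>\<^bsub>extension\<^esub> tensor y"
      using diff by (intro T.M.minus_equality[symmetric]) (auto simp: carrier_extension pairs_closed)
    also have "\<dots> = (- 1) \<odot>\<^bsub>extension\<^esub> tensor y"
      using T.smult_minus_1[of "tensor y"] diff by (simp add: carrier_extension class_ring_simps)
    also have "\<dots> \<in> T.span (pure ` B)"
      using diff by (intro S.smult_closed) simp_all
    finally have "tensor x \<oplus>\<^bsub>extension\<^esub> tensor (- y) \<in> T.span (pure ` B)"
      using diff by (intro S.m_closed)
    then show ?case
      using diff by (simp add: extension_add pairs_closed)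
  next
    case (frag_of a m)
    have "a \<odot>\<^bsub>extension\<^esub> pure m \<in> T.span (pure ` B)"
      using pure[OF frag_of] by (intro S.smult_closed) simp_all
    then show ?case
      using frag_of by (simp add: pure_def extension_smult pairs_closed scale_simps)
  qed
  then show ?thesis
    using S.subset by (auto simp: carrier_extension)
qed

section \<open>Extending linear functionals to the tensor product\<close>

definition eval_pairs :: "('m \<Rightarrow> 'c) \<Rightarrow> ('d \<times> 'm \<Rightarrow>\<^sub>0 int) \<Rightarrow> 'd" where
  "eval_pairs f = weighted_sum of_int (\<lambda>(a, m). a * \<phi> (f m))"

definition extend_functional :: "('m \<Rightarrow> 'c) \<Rightarrow> ('d \<times> 'm \<Rightarrow>\<^sub>0 int) set \<Rightarrow> 'd" where
  "extend_functional f C = eval_pairs f (SOME s. s \<in> carrier pairs \<and> tensor s = C)"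

lemma eval_pairs_add: "eval_pairs f (x + y) = eval_pairs f x + eval_pairs f y"
  unfolding eval_pairs_def by (rule weighted_sum_add) auto

lemma eval_pairs_zero: "eval_pairs f 0 = 0"
  by (simp add: eval_pairs_def)

lemma eval_pairs_diff: "eval_pairs f (x - y) = eval_pairs f x - eval_pairs f y"
  using eval_pairs_add[of f "x - y" y] by simp

lemma eval_pairs_frag_of: "eval_pairs f (frag_of (a, m)) = a * \<phi> (f m)"
  by (simp add: eval_pairs_def weighted_sum_single)

lemma eval_pairs_scale: "s \<in> carrier pairs \<Longrightarrow> eval_pairs f (scale c s) = c * eval_pairs f s"
  by (induction s rule: pairs_induct)
    (simp_all add: scale_simps eval_pairs_zero eval_pairs_diff eval_pairs_frag_of right_diff_distrib mult.assoc)

context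
  fixes f :: "'m \<Rightarrow> 'c"
  assumes f_add: "\<And>x y. x \<in> carrier M \<Longrightarrow> y \<in> carrier M \<Longrightarrow> f (x \<oplus>\<^bsub>M\<^esub> y) = f x + f y"
    and f_smult: "\<And>c x. x \<in> carrier M \<Longrightarrow> f (c \<odot>\<^bsub>M\<^esub> x) = c * f x"
begin

text \<open>The three kinds of tensor relations evaluate to zero by distributivity, by additivity of
  \<open>f\<close> and \<open>\<phi>\<close>, and by homogeneity of \<open>f\<close> with
  multiplicativity of \<open>\<phi>\<close>.\<close>

lemma eval_pairs_kernel:
  assumes "s \<in> kernel"
  shows "eval_pairs f s = 0"
proof -
  let ?H = "{s \<in> carrier pairs. eval_pairs f s = 0}"
  have "subgroup ?H pairs"
    by (rule subgroup_pairsI) (auto simp: pairs_closed eval_pairs_zero eval_pairs_diff)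
  moreover have "tensor_relations (class_ring :: 'd ring) \<phi> (class_ring :: 'c ring) M \<subseteq> ?H"
  proof
    fix s assume s: "s \<in> tensor_relations (class_ring :: 'd ring) \<phi> (class_ring :: 'c ring) M"
    then have "eval_pairs f s = 0"
      unfolding tensor_relations_def
      by (auto simp: eval_pairs_diff eval_pairs_frag_of f_add f_smult \<phi>_add \<phi>_mult distrib_left distrib_right mult.assoc)
    then show "s \<in> ?H"
      using s tensor_relations_closed by auto
  qed
  ultimately have "kernel \<subseteq> ?H"
    by (rule kernel_minimal)
  then show ?thesis
    using assms by blast
qed

lemma extend_functional_tensor:
  assumes x: "x \<in> carrier pairs"
  shows "extend_functional f (tensor x) = eval_pairs f x"
proof -
  let ?y = "SOME y. y \<in> carrier pairs \<and> tensor y = tensor x"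
  have "?y \<in> carrier pairs \<and> tensor ?y = tensor x"
    by (rule someI[of _ x]) (simp add: x)
  then have "?y - x \<in> kernel"
    using tensor_eq_iff x by blast
  then show ?thesis
    using eval_pairs_kernel[of "?y - x"] by (simp add: extend_functional_def eval_pairs_diff)
qed

lemma extend_functional_add:
  "x \<in> carrier extension \<Longrightarrow> y \<in> carrier extension \<Longrightarrow>
    extend_functional f (x \<oplus>\<^bsub>extension\<^esub> y) = extend_functional f x + extend_functional f y"
  by (auto simp: carrier_extension extension_add extend_functional_tensor pairs_closed eval_pairs_add)

lemma extend_functional_smult:
  "x \<in> carrier extension \<Longrightarrow> extend_functional f (c \<odot>\<^bsub>extension\<^esub> x) = c * extend_functional f x"
  by (auto simp: carrier_extension extension_smult extend_functional_tensor scale_closed eval_pairs_scale)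

lemma extend_functional_pure: "m \<in> carrier M \<Longrightarrow> extend_functional f (pure m) = \<phi> (f m)"
  by (simp add: pure_def extend_functional_tensor pairs_closed eval_pairs_frag_of)

end

end

section \<open>The ring map from Laurent polynomials to rational functions\<close>

lemma laurent_to_ratfun_eq:
  "laurent_to_ratfun = weighted_sum (\<lambda>c. to_fract [:c:]) (\<lambda>m. to_fract [:0, 1:] powi m)"
  by (simp add: laurent_to_ratfun_def weighted_sum_def fun_eq_iff)

lemma laurent_to_ratfun_add: "laurent_to_ratfun (f + g) = laurent_to_ratfun f + laurent_to_ratfun g"
  unfolding laurent_to_ratfun_eq by (rule weighted_sum_add) (simp_all flip: to_fract_add)

lemma laurent_to_ratfun_single:
  "laurent_to_ratfun (Poly_Mapping.single m c) = to_fract [:c:] * to_fract [:0, 1:] powi m"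
  unfolding laurent_to_ratfun_eq by (rule weighted_sum_single) simp

lemma laurent_to_ratfun_zero: "laurent_to_ratfun 0 = 0"
  by (simp add: laurent_to_ratfun_def)

lemma laurent_to_ratfun_one: "laurent_to_ratfun 1 = 1"
  using laurent_to_ratfun_single[of 0 1] by (simp flip: one_pCons)

text \<open>Both sides are additive in each factor, so two inductions reduce the claim to monomials,
  where the exponents of the nonzero element \<open>to_fract [:0, 1:]\<close> add.\<close>

lemma laurent_to_ratfun_mult: "laurent_to_ratfun (f * g) = laurent_to_ratfun f * laurent_to_ratfun g"
proof (rule poly_mapping_induct_single[where S = UNIV and f = f])
  fix m c
  show "laurent_to_ratfun (Poly_Mapping.single m c * g) = laurent_to_ratfun (Poly_Mapping.single m c) * laurent_to_ratfun g"
  proof (rule poly_mapping_induct_single[where S = UNIV and f = g])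
    fix k d
    have "to_fract ([:c * d:] :: 'a poly) = to_fract [:c:] * to_fract [:d:]"
      by (simp flip: to_fract_mult)
    then show "laurent_to_ratfun (Poly_Mapping.single m c * Poly_Mapping.single k d)
        = laurent_to_ratfun (Poly_Mapping.single m c) * laurent_to_ratfun (Poly_Mapping.single k d)"
      by (simp add: mult_single laurent_to_ratfun_single power_int_add)
  qed (simp_all add: laurent_to_ratfun_zero laurent_to_ratfun_add distrib_left)
qed (simp_all add: laurent_to_ratfun_zero laurent_to_ratfun_add distrib_right)

lemma laurent_to_ratfun_dvd_one: "x dvd 1 \<Longrightarrow> laurent_to_ratfun x dvd 1"
  by (metis dvdE dvdI laurent_to_ratfun_mult laurent_to_ratfun_one)

theorem theorem4p2p3:
  fixes n :: nat and p :: "nat \<Rightarrow> bit" and r :: "(nat \<times> nat) rel"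
  assumes "n \<ge> 2"
    and "linear_order_on (generators n) r"
  shows "inj_on (monomial n p r :: _ \<Rightarrow> 'k::field_char_0 free_alg set) (exponents n p)
    \<and> module_basis class_ring (Fq_int n p) (monomials n p r :: 'k free_alg set set)
    \<and> free_module class_ring (Fq_int n p :: ('k laurent, 'k free_alg set) module)
    \<and> inj_on (to_Fq n p) (monomials n p r :: 'k free_alg set set)
    \<and> module_basis class_ring (Fq n p) (to_Fq n p ` (monomials n p r :: 'k free_alg set set))"
proof -
  let ?gs = "ordered_generators n r"
  let ?M = "Fq_int n p :: ('k laurent, 'k free_alg set) module"
  define v :: "(nat \<times> nat \<Rightarrow> nat) \<Rightarrow> 'k free_alg set" where "v e = coset n p (word (monomial_word ?gs e))" for e
  define wt where "wt e = weight (monomial_word ?gs e)" for e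
  note gs = ordered_generators[OF assms(2)]
  have monomial: "monomial n p r = v"
    unfolding v_def by (intro ext monomial_eq[OF assms(2)])
  have span: "v ` exponents n p \<subseteq> carrier ?M"
    "LinearCombinations.module.span class_ring ?M (v ` exponents n p) = carrier ?M"
    using span_monomials[OF gs] unfolding v_def by blast+
  obtain t where
    unit: "\<And>e. e \<in> exponents n p \<Longrightarrow> coord n p (t e) (v e) dvd 1" and
    tri: "\<And>e e'. e \<in> exponents n p \<Longrightarrow> e' \<in> exponents n p \<Longrightarrow> e \<noteq> e' \<Longrightarrow> wt e' \<le> wt e \<Longrightarrow> coord n p (t e) (v e') = 0"
    using coord_triangular[OF gs, where p = p and 'k = 'k] unfolding v_def wt_def by blast
  have int: "inj_on v (exponents n p)" "\<not> LinearCombinations.module.lin_dep class_ring ?M (v ` exponents n p)"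
    using triangular_functionals_independent[of ?M v "exponents n p" "\<lambda>e. coord n p (t e)" wt]
    by (simp_all add: module_Fq_int span coord_add coord_smult unit tri)
  then have basis: "module_basis class_ring ?M (v ` exponents n p)"
    using span by (simp add: module_basis_def module_Fq_int)
  interpret E: scalar_extension "laurent_to_ratfun :: 'k laurent \<Rightarrow> 'k ratfun" ?M
    by (intro scalar_extension.intro laurent_to_ratfun_add laurent_to_ratfun_mult laurent_to_ratfun_one
        module_Fq_int)
  have Fq: "Fq n p = E.extension"
    by (simp add: Fq_def E.extension_def)
  have to_Fq: "to_Fq n p = E.pure"
    unfolding to_Fq_def fun_eq_iff pure_tensor_def E.pure_def E.tensor_def E.kernel_def E.pairs_def by blast
  \<comment> \<open>Independence over the rational functions is not deduced from independence over
    the Laurent polynomials. The coordinates themselves are extended; a ring map sends units to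
    units and zero to zero, so they stay triangular.\<close>
  define f where "f e = E.extend_functional (coord n p (t e))" for e
  have f_add: "f e (x \<oplus>\<^bsub>E.extension\<^esub> y) = f e x + f e y"
    if "x \<in> carrier E.extension" "y \<in> carrier E.extension" for e x y
    unfolding f_def by (rule E.extend_functional_add[OF coord_add coord_smult that])
  have f_smult: "f e (c \<odot>\<^bsub>E.extension\<^esub> x) = c * f e x" if "x \<in> carrier E.extension" for e c x
    unfolding f_def by (rule E.extend_functional_smult[OF coord_add coord_smult that])
  have f_pure: "f e (E.pure (v e')) = laurent_to_ratfun (coord n p (t e) (v e'))" if "e' \<in> exponents n p" for e e'
    unfolding f_def by (rule E.extend_functional_pure[OF coord_add coord_smult]) (use span that in auto)
  have pure_closed: "(\<lambda>e. E.pure (v e)) ` exponents n p \<subseteq> carrier E.extension"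
    using span E.pure_closed by auto
  have ext: "inj_on (\<lambda>e. E.pure (v e)) (exponents n p)"
    "\<not> LinearCombinations.module.lin_dep class_ring E.extension ((\<lambda>e. E.pure (v e)) ` exponents n p)"
    using triangular_functionals_independent[of E.extension "\<lambda>e. E.pure (v e)" "exponents n p" f wt]
    by (simp_all add: E.module_extension pure_closed f_add f_smult f_pure unit tri
        laurent_to_ratfun_dvd_one laurent_to_ratfun_zero)
  have image: "E.pure ` v ` exponents n p = (\<lambda>e. E.pure (v e)) ` exponents n p"
    by (simp add: image_image)
  have "inj_on E.pure (v ` exponents n p)"
    using ext(1) by (intro inj_on_imageI) (simp add: comp_def)
  moreover have "module_basis class_ring E.extension (E.pure ` v ` exponents n p)"
    using E.span_extension[OF span] ext(2) pure_closed
    by (simp add: module_basis_def E.module_extension image)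
  ultimately show ?thesis
    using int basis unfolding monomials_def monomial Fq to_Fq free_module_def by blast
qed

end
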